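(* Let $a_0, b_0$ be scalars with $0 < |b_0| \le |a_0|$, let $F$ be the operator on $H^2(\mathbb{D})$ with $F1 = ((a_0-1) + b_0 z)z$ and $Fz^m = 0$ for $m \ge 1$, and let $S_1 = M_z + F$. Let $\mathcal{M}\subseteq H^2(\mathbb{D})$ be a nonzero closed $S_1$-invariant subspace. Then $\mathcal{M} = [\mathcal{M}\ominus S_1\mathcal{M}]_{S_1}$ if and only if there exist an inner function $\theta\in H^\infty(\mathbb{D})$, an outer polynomial $p\in\mathbb{C}[z]$ and a vector $\varphi$ such that $\mathcal{M}\ominus S_1\mathcal{M} = \mathbb{C}\varphi$ and $S_1\varphi = zp\theta$.
   Context: $H^2(\mathbb{D})$ is the Hardy space on the open unit disc, $M_z$ the unilateral shift on it, and $H^\infty(\mathbb{D})$ the bounded analytic functions. For a bounded operator $T$ and a set $S$ of vectors, $[S]_T$ is the smallest closed $T$-invariant subspace containing $S$ (for $S=\{f\}$, the closure of $\{p(T)f: p\in\mathbb{C}[z]\}$). A polynomial $p$ is outer if $\overline{\{qp:q\in\mathbb{C}[z]\}}=H^2(\mathbb{D})$. *)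

theory Defs
  imports "HOL-Analysis.Analysis" "HOL-Computational_Algebra.Polynomial"
begin

text \<open>H^2(D) is modelled by Taylor coefficient sequences: f(z) = sum_n f n * z^n.\<close>

definition H2 :: "(nat \<Rightarrow> complex) set" where
  "H2 = {a. summable (\<lambda>n. (cmod (a n))\<^sup>2)}"

definition h2_inner :: "(nat \<Rightarrow> complex) \<Rightarrow> (nat \<Rightarrow> complex) \<Rightarrow> complex" where
  "h2_inner x y = (\<Sum>n. x n * cnj (y n))"

definition h2_norm :: "(nat \<Rightarrow> complex) \<Rightarrow> real" where
  "h2_norm x = sqrt (\<Sum>n. (cmod (x n))\<^sup>2)"

definition h2_closed :: "(nat \<Rightarrow> complex) set \<Rightarrow> bool" where
  "h2_closed M \<longleftrightarrow> (\<forall>x y. (\<forall>k. x k \<in> M) \<and> y \<in> H2 \<and>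
      ((\<lambda>k. h2_norm (\<lambda>n. x k n - y n)) \<longlonglongrightarrow> 0) \<longrightarrow> y \<in> M)"

definition closed_subspace :: "(nat \<Rightarrow> complex) set \<Rightarrow> bool" where
  "closed_subspace M \<longleftrightarrow> M \<subseteq> H2 \<and> (\<lambda>n. 0) \<in> M \<and>
     (\<forall>x\<in>M. \<forall>y\<in>M. (\<lambda>n. x n + y n) \<in> M) \<and>
     (\<forall>c. \<forall>x\<in>M. (\<lambda>n. c * x n) \<in> M) \<and> h2_closed M"

definition gen_inv :: "((nat \<Rightarrow> complex) \<Rightarrow> (nat \<Rightarrow> complex)) \<Rightarrow> (nat \<Rightarrow> complex) set
    \<Rightarrow> (nat \<Rightarrow> complex) set" where
  "gen_inv T S = \<Inter>{N. closed_subspace N \<and> S \<subseteq> N \<and> T ` N \<subseteq> N}"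

definition ominus :: "(nat \<Rightarrow> complex) set \<Rightarrow> (nat \<Rightarrow> complex) set \<Rightarrow> (nat \<Rightarrow> complex) set" where
  "ominus M N = {x\<in>M. \<forall>y\<in>N. h2_inner x y = 0}"

definition Mz :: "(nat \<Rightarrow> complex) \<Rightarrow> (nat \<Rightarrow> complex)" where
  "Mz a = (\<lambda>n. if n = 0 then 0 else a (n - 1))"

text \<open>F 1 = ((a0 - 1) + b0 z) z and F z^m = 0 for m >= 1, i.e. F f = f(0) * F 1.\<close>
definition Fop :: "complex \<Rightarrow> complex \<Rightarrow> (nat \<Rightarrow> complex) \<Rightarrow> (nat \<Rightarrow> complex)" where
  "Fop a0 b0 a = (\<lambda>n. a 0 * (if n = 1 then a0 - 1 else if n = 2 then b0 else 0))"

definition S1 :: "complex \<Rightarrow> complex \<Rightarrow> (nat \<Rightarrow> complex) \<Rightarrow> (nat \<Rightarrow> complex)" where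
  "S1 a0 b0 a = (\<lambda>n. Mz a n + Fop a0 b0 a n)"

definition poly_seq :: "complex poly \<Rightarrow> (nat \<Rightarrow> complex)" where
  "poly_seq p = (\<lambda>n. coeff p n)"

definition outer_poly :: "complex poly \<Rightarrow> bool" where
  "outer_poly p \<longleftrightarrow> (\<forall>f\<in>H2. \<forall>e>0. \<exists>q. h2_norm (\<lambda>n. f n - poly_seq (q * p) n) < e)"

definition inner_fun :: "(complex \<Rightarrow> complex) \<Rightarrow> bool" where
  "inner_fun \<theta> \<longleftrightarrow> \<theta> holomorphic_on ball 0 1 \<and> bounded (\<theta> ` ball 0 1) \<and>
     (AE t in lborel. t \<in> {0..2*pi} \<longrightarrow>
        (\<exists>l. cmod l = 1 \<and> ((\<lambda>r. \<theta> (complex_of_real r * cis t)) \<longlongrightarrow> l) (at_left 1)))"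

end

theory Submission
  imports Defs "HOL-Complex_Analysis.Complex_Analysis"
begin

text \<open>Write \<open>S1 = Mz \<circ> L\<close> with \<open>L f = f + f(0) ((a0 - 1) + b0 z)\<close>. The operator \<open>L\<close> is invertible and fixes
  \<open>z H2\<close>, so \<open>N = L M\<close> is a closed shift-invariant subspace with \<open>S1 M = z N\<close>, and Beurling's theorem
  gives \<open>N = u H2\<close> with \<open>u\<close> inner. Orthogonality to \<open>z u H2\<close> forces \<open>M \<ominus> S1 M\<close> to be spanned by the vector
  \<open>\<phi>\<close> with \<open>L \<phi> = u (a0 + b0 |u(0)|^2 z)\<close>. Since \<open>|b0| |u(0)|^2 \<le> |a0|\<close>, this linear polynomial is
  outer, so \<open>z u H2\<close> lies in the subspace generated by \<open>\<phi>\<close>. Hence both sides of the equivalence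
  hold for every \<open>M\<close>.

  The radial limits of \<open>u\<close> come from Fatou's theorem: the primitive of \<open>u\<close> is continuous on the closed
  disc and absolutely continuous on the circle, hence differentiable almost everywhere there.\<close>

section \<open>The sequence space\<close>

text \<open>The coefficient \<open>b0 |u(0)|^2\<close> solves one equation. For
  \<open>p(z) = a0 + c z\<close>, undoing \<open>L\<close> subtracts
  \<open>u(0) ((a0 - 1) + b0 z)\<close> from \<open>u p\<close>; pairing the result with
  \<open>z u\<close> gives \<open>c - u(0) b0 cnj (u(0))\<close>, and the pairings with
  \<open>z ^ k u\<close>, \<open>k > 1\<close>, vanish for every \<open>c\<close>. The norm of
  \<open>u\<close> is one, so \<open>|u(0)| <= 1\<close> and the zero of \<open>p\<close> stays out
  of the open disc. It may still lie on the circle, where \<open>1 / p\<close> is not in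
  \<open>H2\<close>, so outerness cannot be obtained by inverting \<open>p\<close> and needs an
  averaged inverse.

  The longest stretch serves a change of language. Beurling's theorem yields \<open>u\<close> as a
  coefficient sequence whose shifts are orthonormal, which is all that the operator theory uses. The
  statement asks for a bounded function with radial limits of modulus one almost everywhere. The
  passage needs three facts of different nature: the limits exist, they have modulus at most one,
  and their mean square is not less than one.\<close>

definition h2_normsq :: "(nat \<Rightarrow> complex) \<Rightarrow> real" where
  "h2_normsq x = (\<Sum>n. (cmod (x n))\<^sup>2)"

lemma h2_norm_eq_sqrt: "h2_norm x = sqrt (h2_normsq x)"
  by (simp add: h2_norm_def h2_normsq_def)

lemma H2_zero [simp]: "(\<lambda>n. 0) \<in> H2"
  by (simp add: H2_def)

lemma H2_finite_support:
  assumes "\<And>n. n \<ge> N \<Longrightarrow> x n = 0"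
  shows "x \<in> H2"
  unfolding H2_def mem_Collect_eq
  by (rule summable_finite[of "{..<N}"]) (auto simp: assms)

lemma H2_summable_prod:
  assumes "x \<in> H2" "y \<in> H2"
  shows "summable (\<lambda>n. cmod (x n) * cmod (y n))"
proof (rule summable_comparison_test')
  show "summable (\<lambda>n. (cmod (x n))\<^sup>2 + (cmod (y n))\<^sup>2)"
    using assms by (intro summable_add) (auto simp: H2_def)
  show "norm (cmod (x n) * cmod (y n)) \<le> (cmod (x n))\<^sup>2 + (cmod (y n))\<^sup>2" if "n \<ge> 0" for n
  proof -
    have "0 \<le> cmod (x n) * cmod (y n)" by simp
    then show ?thesis
      using sum_squares_bound[of "cmod (x n)" "cmod (y n)"] by (simp only: real_norm_def abs_of_nonneg)
  qed
qed

lemma H2_summable_inner: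
  assumes "x \<in> H2" "y \<in> H2"
  shows "summable (\<lambda>n. x n * cnj (y n))"
  by (rule summable_norm_cancel) (use H2_summable_prod[OF assms] in \<open>simp add: norm_mult\<close>)

lemma sums_h2_normsq: "x \<in> H2 \<Longrightarrow> (\<lambda>n. (cmod (x n))\<^sup>2) sums h2_normsq x"
  by (simp add: H2_def h2_normsq_def summable_sums)

lemma sum_le_h2_normsq:
  assumes "x \<in> H2" "finite A"
  shows "(\<Sum>n\<in>A. (cmod (x n))\<^sup>2) \<le> h2_normsq x"
  unfolding h2_normsq_def using assms by (intro sum_le_suminf) (auto simp: H2_def)

lemma h2_normsq_nonneg: "x \<in> H2 \<Longrightarrow> 0 \<le> h2_normsq x"
  using sum_le_h2_normsq[of x "{}"] by simp

lemma h2_norm_nonneg: "x \<in> H2 \<Longrightarrow> 0 \<le> h2_norm x"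
  by (simp add: h2_norm_eq_sqrt h2_normsq_nonneg)

lemma h2_norm_power2: "x \<in> H2 \<Longrightarrow> (h2_norm x)\<^sup>2 = h2_normsq x"
  by (simp add: h2_norm_eq_sqrt h2_normsq_nonneg)

text \<open>A bound on finite sections that does not depend on their length gives membership and the
  norm bound together. This treats vectors known only coefficientwise, such as sums, limits and
  products.\<close>

lemma H2_normsq_leI:
  assumes "\<And>K. (\<Sum>n<K. (cmod (x n))\<^sup>2) \<le> B"
  shows "x \<in> H2" "h2_normsq x \<le> B"
proof -
  have s: "summable (\<lambda>n. (cmod (x n))\<^sup>2)"
    by (rule summableI_nonneg_bounded[of _ B]) (use assms in auto)
  then show "x \<in> H2" by (simp add: H2_def)
  show "h2_normsq x \<le> B" unfolding h2_normsq_def by (rule suminf_le_const[OF s assms])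
qed

lemma cmod_le_h2_norm: "x \<in> H2 \<Longrightarrow> cmod (x n) \<le> h2_norm x"
  using sum_le_h2_normsq[of x "{n}"] by (simp add: h2_norm_eq_sqrt real_le_rsqrt)

lemma h2_normsq_eq_0:
  assumes "x \<in> H2" "h2_normsq x = 0"
  shows "x = (\<lambda>n. 0)"
proof
  fix n
  show "x n = 0"
    using sum_le_h2_normsq[OF assms(1), of "{n}"] assms(2) by simp
qed

lemma L2_set_le_h2_norm:
  assumes "x \<in> H2" "finite A"
  shows "L2_set (\<lambda>n. cmod (x n)) A \<le> h2_norm x"
  unfolding L2_set_def h2_norm_eq_sqrt using sum_le_h2_normsq[OF assms] by simp

lemma H2_add_norm:
  assumes "x \<in> H2" "y \<in> H2"
  shows "(\<lambda>n. x n + y n) \<in> H2" "h2_norm (\<lambda>n. x n + y n) \<le> h2_norm x + h2_norm y"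
proof -
  have nn: "0 \<le> h2_norm x + h2_norm y"
    using assms by (simp add: h2_norm_nonneg)
  have "(\<Sum>n<K. (cmod (x n + y n))\<^sup>2) \<le> (h2_norm x + h2_norm y)\<^sup>2" for K
  proof -
    have "L2_set (\<lambda>n. cmod (x n + y n)) {..<K} \<le> L2_set (\<lambda>n. cmod (x n) + cmod (y n)) {..<K}"
      by (rule L2_set_mono) (auto intro: norm_triangle_ineq)
    also have "\<dots> \<le> L2_set (\<lambda>n. cmod (x n)) {..<K} + L2_set (\<lambda>n. cmod (y n)) {..<K}"
      by (rule L2_set_triangle_ineq)
    also have "\<dots> \<le> h2_norm x + h2_norm y"
      using assms by (intro add_mono L2_set_le_h2_norm) auto
    finally show ?thesis
      unfolding L2_set_def by (rule sqrt_le_D)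
  qed
  note * = H2_normsq_leI[of "\<lambda>n. x n + y n", OF this]
  show "(\<lambda>n. x n + y n) \<in> H2" by (rule *(1))
  show "h2_norm (\<lambda>n. x n + y n) \<le> h2_norm x + h2_norm y"
    using *(2) nn by (simp add: h2_norm_eq_sqrt real_le_lsqrt)
qed

lemmas H2_add = H2_add_norm(1)
lemmas h2_norm_triangle = H2_add_norm(2)

lemma H2_scale: "x \<in> H2 \<Longrightarrow> (\<lambda>n. c * x n) \<in> H2"
  by (simp add: H2_def norm_mult power_mult_distrib summable_mult)

lemma h2_normsq_scale: "x \<in> H2 \<Longrightarrow> h2_normsq (\<lambda>n. c * x n) = (cmod c)\<^sup>2 * h2_normsq x"
  by (simp add: H2_def h2_normsq_def norm_mult power_mult_distrib suminf_mult)

lemma h2_norm_scale: "x \<in> H2 \<Longrightarrow> h2_norm (\<lambda>n. c * x n) = cmod c * h2_norm x"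
  by (simp add: h2_norm_eq_sqrt h2_normsq_scale real_sqrt_mult)

lemma H2_diff: "x \<in> H2 \<Longrightarrow> y \<in> H2 \<Longrightarrow> (\<lambda>n. x n - y n) \<in> H2"
  using H2_add[of x "\<lambda>n. -1 * y n"] H2_scale[of y "-1"] by simp

lemma H2_sum: "(\<And>k. k \<in> A \<Longrightarrow> e k \<in> H2) \<Longrightarrow> (\<lambda>n. \<Sum>k\<in>A. c k * e k n) \<in> H2"
  by (induction A rule: infinite_finite_induct) (auto intro!: H2_add H2_scale)

lemma h2_norm_minus_commute: "h2_norm (\<lambda>n. x n - y n) = h2_norm (\<lambda>n. y n - x n)"
  by (simp add: h2_norm_def norm_minus_commute)

lemma h2_norm_triangle_diff:
  assumes "x \<in> H2" "y \<in> H2" "z \<in> H2"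
  shows "h2_norm (\<lambda>n. x n - z n) \<le> h2_norm (\<lambda>n. x n - y n) + h2_norm (\<lambda>n. y n - z n)"
  using h2_norm_triangle[of "\<lambda>n. x n - y n" "\<lambda>n. y n - z n"] assms
  by (simp add: H2_diff)

lemma h2_norm_diff_le:
  assumes "x \<in> H2" "y \<in> H2"
  shows "\<bar>h2_norm x - h2_norm y\<bar> \<le> h2_norm (\<lambda>n. x n - y n)"
  using h2_norm_triangle_diff[OF assms H2_zero] h2_norm_triangle_diff[OF assms(2,1) H2_zero]
    h2_norm_minus_commute[of x y]
  by (simp add: abs_le_iff)

lemma h2_inner_Cauchy_Schwarz:
  assumes "x \<in> H2" "y \<in> H2"
  shows "cmod (h2_inner x y) \<le> h2_norm x * h2_norm y"
proof -
  have s: "summable (\<lambda>n. norm (x n * cnj (y n)))"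
    using H2_summable_prod[OF assms] by (simp add: norm_mult)
  have "cmod (h2_inner x y) \<le> (\<Sum>n. norm (x n * cnj (y n)))"
    unfolding h2_inner_def by (rule summable_norm[OF s])
  also have "\<dots> \<le> h2_norm x * h2_norm y"
  proof (rule suminf_le_const[OF s])
    fix K
    have "(\<Sum>n<K. norm (x n * cnj (y n))) = (\<Sum>n<K. \<bar>cmod (x n)\<bar> * \<bar>cmod (y n)\<bar>)"
      by (simp add: norm_mult)
    also have "\<dots> \<le> L2_set (\<lambda>n. cmod (x n)) {..<K} * L2_set (\<lambda>n. cmod (y n)) {..<K}"
      by (rule L2_set_mult_ineq)
    also have "\<dots> \<le> h2_norm x * h2_norm y"
      using assms by (intro mult_mono L2_set_le_h2_norm h2_norm_nonneg) auto
    finally show "(\<Sum>n<K. norm (x n * cnj (y n))) \<le> h2_norm x * h2_norm y" .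
  qed
  finally show ?thesis .
qed

lemma h2_inner_add_left:
  "x \<in> H2 \<Longrightarrow> y \<in> H2 \<Longrightarrow> z \<in> H2 \<Longrightarrow> h2_inner (\<lambda>n. x n + y n) z = h2_inner x z + h2_inner y z"
  by (simp add: h2_inner_def distrib_right suminf_add[symmetric] H2_summable_inner)

lemma h2_inner_diff_left:
  "x \<in> H2 \<Longrightarrow> y \<in> H2 \<Longrightarrow> z \<in> H2 \<Longrightarrow> h2_inner (\<lambda>n. x n - y n) z = h2_inner x z - h2_inner y z"
  by (simp add: h2_inner_def left_diff_distrib suminf_diff[symmetric] H2_summable_inner)

lemma h2_inner_scale_left:
  "x \<in> H2 \<Longrightarrow> z \<in> H2 \<Longrightarrow> h2_inner (\<lambda>n. c * x n) z = c * h2_inner x z"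
  by (simp add: h2_inner_def mult.assoc suminf_mult H2_summable_inner)

lemma h2_inner_cnj:
  assumes "x \<in> H2" "y \<in> H2"
  shows "h2_inner y x = cnj (h2_inner x y)"
proof -
  have "(\<lambda>n. cnj (x n * cnj (y n))) sums cnj (h2_inner x y)"
    unfolding sums_cnj h2_inner_def by (rule summable_sums[OF H2_summable_inner[OF assms]])
  then show ?thesis
    unfolding h2_inner_def by (simp add: sums_iff mult.commute)
qed

lemma h2_inner_zero [simp]: "h2_inner (\<lambda>n. 0) y = 0" "h2_inner x (\<lambda>n. 0) = 0"
  by (simp_all add: h2_inner_def)

lemma h2_inner_sum_left:
  assumes "\<And>k. k \<in> A \<Longrightarrow> e k \<in> H2" "y \<in> H2"
  shows "h2_inner (\<lambda>n. \<Sum>k\<in>A. c k * e k n) y = (\<Sum>k\<in>A. c k * h2_inner (e k) y)"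
  using assms(1)
proof (induction A rule: infinite_finite_induct)
  case (insert a A)
  then show ?case
    using assms(2) by (simp add: h2_inner_add_left h2_inner_scale_left H2_scale H2_sum)
qed auto

lemma h2_inner_self: "x \<in> H2 \<Longrightarrow> h2_inner x x = of_real (h2_normsq x)"
proof -
  assume "x \<in> H2"
  then have "(\<lambda>n. complex_of_real ((cmod (x n))\<^sup>2)) sums of_real (h2_normsq x)"
    by (intro sums_of_real sums_h2_normsq)
  then show ?thesis
    unfolding h2_inner_def by (simp add: sums_iff complex_norm_square flip: of_real_power)
qed

lemma h2_normsq_add:
  assumes "x \<in> H2" "y \<in> H2"
  shows "h2_normsq (\<lambda>n. x n + y n) = h2_normsq x + h2_normsq y + 2 * Re (h2_inner x y)"
proof -
  have "complex_of_real (h2_normsq (\<lambda>n. x n + y n)) =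
      h2_inner (\<lambda>n. x n + y n) (\<lambda>n. x n + y n)"
    using assms by (simp add: h2_inner_self H2_add)
  also have "\<dots> = h2_inner x (\<lambda>n. x n + y n) + h2_inner y (\<lambda>n. x n + y n)"
    using assms by (simp add: h2_inner_add_left H2_add)
  also have "\<dots> = cnj (h2_inner (\<lambda>n. x n + y n) x) + cnj (h2_inner (\<lambda>n. x n + y n) y)"
    using assms h2_inner_cnj[OF H2_add[OF assms] assms(1)] h2_inner_cnj[OF H2_add[OF assms] assms(2)] by simp
  also have "\<dots> = cnj (h2_inner x x) + cnj (h2_inner y x) + cnj (h2_inner x y) + cnj (h2_inner y y)"
    using assms by (simp add: h2_inner_add_left)
  finally have "Re (complex_of_real (h2_normsq (\<lambda>n. x n + y n))) =
      Re (cnj (h2_inner x x) + cnj (h2_inner y x) + cnj (h2_inner x y) + cnj (h2_inner y y))"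
    by simp
  then show ?thesis
    using assms h2_inner_cnj[OF assms] by (simp add: h2_inner_self)
qed

lemma h2_normsq_parallelogram:
  assumes "x \<in> H2" "y \<in> H2"
  shows "h2_normsq (\<lambda>n. x n + y n) + h2_normsq (\<lambda>n. x n - y n) = 2 * h2_normsq x + 2 * h2_normsq y"
proof -
  have "h2_normsq (\<lambda>n. x n - y n) = h2_normsq x + h2_normsq (\<lambda>n. -1 * y n) + 2 * Re (h2_inner x (\<lambda>n. -1 * y n))"
    using h2_normsq_add[OF assms(1) H2_scale[OF assms(2), of "-1"]] by simp
  moreover have "h2_inner x (\<lambda>n. -1 * y n) = - h2_inner x y"
    using h2_inner_cnj[OF H2_scale[OF assms(2), of "-1"] assms(1)] h2_inner_cnj[OF assms(2,1)]
      h2_inner_scale_left[OF assms(2,1), of "-1"] by simp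
  moreover have "h2_normsq (\<lambda>n. -1 * y n) = h2_normsq y"
    using h2_normsq_scale[OF assms(2), of "-1"] by simp
  ultimately show ?thesis
    using h2_normsq_add[OF assms] by simp
qed

lemma h2_inner_tendsto_left:
  assumes "\<And>k. x k \<in> H2" "y \<in> H2" "z \<in> H2"
    and "(\<lambda>k. h2_norm (\<lambda>n. x k n - y n)) \<longlonglongrightarrow> 0"
  shows "(\<lambda>k. h2_inner (x k) z) \<longlonglongrightarrow> h2_inner y z"
proof -
  have "(\<lambda>k. h2_norm (\<lambda>n. x k n - y n) * h2_norm z) \<longlonglongrightarrow> 0"
    using tendsto_mult_right[OF assms(4), of "h2_norm z"] by simp
  then have "(\<lambda>k. h2_inner (x k) z - h2_inner y z) \<longlonglongrightarrow> 0"
  proof (rule Lim_null_comparison[rotated])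
    have "norm (h2_inner (x k) z - h2_inner y z) \<le> h2_norm (\<lambda>n. x k n - y n) * h2_norm z" for k
      using h2_inner_Cauchy_Schwarz[OF H2_diff[OF assms(1,2)] assms(3), of k] assms
      by (simp add: h2_inner_diff_left)
    then show "\<forall>\<^sub>F k in sequentially. norm (h2_inner (x k) z - h2_inner y z) \<le> h2_norm (\<lambda>n. x k n - y n) * h2_norm z"
      by simp
  qed
  then show ?thesis by (rule LIM_zero_cancel)
qed

lemma h2_norm_tendsto:
  assumes "\<And>k. x k \<in> H2" "y \<in> H2"
    and "(\<lambda>k. h2_norm (\<lambda>n. x k n - y n)) \<longlonglongrightarrow> 0"
  shows "(\<lambda>k. h2_norm (x k)) \<longlonglongrightarrow> h2_norm y"
proof -
  have "(\<lambda>k. h2_norm (x k) - h2_norm y) \<longlonglongrightarrow> 0"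
    by (rule Lim_null_comparison[OF _ assms(3)])
      (use h2_norm_diff_le[OF assms(1,2)] in simp)
  then show ?thesis by (rule LIM_zero_cancel)
qed

lemma h2_coord_tendsto:
  assumes "\<And>k. x k \<in> H2" "y \<in> H2"
    and "(\<lambda>k. h2_norm (\<lambda>n. x k n - y n)) \<longlonglongrightarrow> 0"
  shows "(\<lambda>k. x k n) \<longlonglongrightarrow> y n"
proof -
  have "(\<lambda>k. x k n - y n) \<longlonglongrightarrow> 0"
    by (rule Lim_null_comparison[OF _ assms(3)])
      (use cmod_le_h2_norm[OF H2_diff[OF assms(1,2)]] in simp)
  then show ?thesis by (rule LIM_zero_cancel)
qed

text \<open>The hypothesis provides an explicit rate because this is what the parallelogram law
  yields for minimising sequences.\<close>
lemma H2_complete: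
  assumes x: "\<And>k. x k \<in> H2"
    and cauchy: "\<And>k l. l \<ge> k \<Longrightarrow> h2_normsq (\<lambda>n. x k n - x l n) \<le> \<epsilon> k"
    and eps: "\<epsilon> \<longlonglongrightarrow> 0"
  obtains y where "y \<in> H2" "(\<lambda>k. h2_norm (\<lambda>n. x k n - y n)) \<longlonglongrightarrow> 0"
proof -
  have coord: "cmod (x k n - x l n) \<le> sqrt (\<epsilon> k)" if "l \<ge> k" for k l n
  proof -
    have "(cmod (x k n - x l n))\<^sup>2 \<le> h2_normsq (\<lambda>n. x k n - x l n)"
      using sum_le_h2_normsq[of "\<lambda>n. x k n - x l n" "{n}"] x by (simp add: H2_diff)
    then show ?thesis
      using cauchy[OF that] by (intro real_le_rsqrt) simp
  qed
  have "Cauchy (\<lambda>k. x k n)" for n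
  proof (rule metric_CauchyI)
    fix e :: real assume "e > 0"
    have "(\<lambda>k. sqrt (\<epsilon> k)) \<longlonglongrightarrow> 0" using tendsto_real_sqrt[OF eps] by simp
    then have "\<forall>\<^sub>F k in sequentially. sqrt (\<epsilon> k) < e / 2"
      using \<open>e > 0\<close> by (intro order_tendstoD(2)) auto
    then obtain M where M: "sqrt (\<epsilon> M) < e / 2" by (auto simp: eventually_sequentially)
    have "dist (x k n) (x l n) < e" if "k \<ge> M" "l \<ge> M" for k l
      using coord[OF that(1), of n] coord[OF that(2), of n] M
        dist_triangle[of "x k n" "x l n" "x M n"]
      by (simp add: dist_norm norm_minus_commute)
    then show "\<exists>M. \<forall>m\<ge>M. \<forall>k\<ge>M. dist (x m n) (x k n) < e" by blast
  qed
  then have "\<forall>n. \<exists>y. (\<lambda>k. x k n) \<longlonglongrightarrow> y"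
    by (simp add: Cauchy_convergent_iff convergent_def)
  then obtain y where y: "\<And>n. (\<lambda>k. x k n) \<longlonglongrightarrow> y n" by metis
  \<comment> \<open>Coordinatewise limits suffice here: \<open>l\<close> tends to infinity inside a
    finite section, and the bound is uniform in \<open>K\<close>.\<close>
  have bd: "(\<Sum>n<K. (cmod (x k n - y n))\<^sup>2) \<le> \<epsilon> k" for K k
  proof (rule tendsto_upperbound)
    show "(\<lambda>l. \<Sum>n<K. (cmod (x k n - x l n))\<^sup>2) \<longlonglongrightarrow> (\<Sum>n<K. (cmod (x k n - y n))\<^sup>2)"
      by (intro tendsto_intros y)
    show "\<forall>\<^sub>F l in sequentially. (\<Sum>n<K. (cmod (x k n - x l n))\<^sup>2) \<le> \<epsilon> k"
      using eventually_ge_at_top[of k]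
    proof eventually_elim
      case (elim l)
      show ?case
        using sum_le_h2_normsq[of "\<lambda>n. x k n - x l n" "{..<K}"] cauchy[OF elim] x by (simp add: H2_diff)
    qed
  qed simp
  note d = H2_normsq_leI[of "\<lambda>n. x k n - y n" for k, OF bd]
  have "y \<in> H2"
    using H2_diff[OF x[of 0] d(1)[of 0]] by simp
  moreover have "(\<lambda>k. h2_norm (\<lambda>n. x k n - y n)) \<longlonglongrightarrow> 0"
  proof (rule Lim_null_comparison)
    show "(\<lambda>k. sqrt (\<epsilon> k)) \<longlonglongrightarrow> 0" using tendsto_real_sqrt[OF eps] by simp
    show "\<forall>\<^sub>F k in sequentially. norm (h2_norm (\<lambda>n. x k n - y n)) \<le> sqrt (\<epsilon> k)"
      using d by (simp add: h2_norm_eq_sqrt h2_normsq_nonneg)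
  qed
  ultimately show ?thesis by (rule that)
qed

section \<open>Closed subspaces and extremal vectors\<close>

lemma closed_subspace_subset: "closed_subspace N \<Longrightarrow> x \<in> N \<Longrightarrow> x \<in> H2"
  and closed_subspace_zero: "closed_subspace N \<Longrightarrow> (\<lambda>n. 0) \<in> N"
  and closed_subspace_add: "closed_subspace N \<Longrightarrow> x \<in> N \<Longrightarrow> y \<in> N \<Longrightarrow> (\<lambda>n. x n + y n) \<in> N"
  and closed_subspace_scale: "closed_subspace N \<Longrightarrow> x \<in> N \<Longrightarrow> (\<lambda>n. c * x n) \<in> N"
  and closed_subspace_lim: "closed_subspace N \<Longrightarrow> (\<And>k. u k \<in> N) \<Longrightarrow> y \<in> H2 \<Longrightarrow>
    (\<lambda>k. h2_norm (\<lambda>n. u k n - y n)) \<longlonglongrightarrow> 0 \<Longrightarrow> y \<in> N"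
  unfolding closed_subspace_def h2_closed_def by blast+

lemma closed_subspace_diff:
  "closed_subspace N \<Longrightarrow> x \<in> N \<Longrightarrow> y \<in> N \<Longrightarrow> (\<lambda>n. x n - y n) \<in> N"
  using closed_subspace_add[of N x "\<lambda>n. -1 * y n"] closed_subspace_scale[of N y "-1"] by simp

lemma closed_subspace_sum:
  "closed_subspace N \<Longrightarrow> (\<And>k. k \<in> A \<Longrightarrow> e k \<in> N) \<Longrightarrow> (\<lambda>n. \<Sum>k\<in>A. c k * e k n) \<in> N"
  by (induction A rule: infinite_finite_induct)
    (auto intro!: closed_subspace_add closed_subspace_scale closed_subspace_zero)

text \<open>Take the vector of minimal norm in the affine subspace \<open>{f \<in> N. f m = 1}\<close>.\<close>
lemma extremal_vector:
  assumes N: "closed_subspace N" and "f \<in> N" "f m \<noteq> 0"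
  obtains u where "u \<in> N" "u m = 1" "\<And>w. w \<in> N \<Longrightarrow> w m = 0 \<Longrightarrow> h2_inner u w = 0"
proof -
  define A where "A = {g \<in> N. g m = 1}"
  define d where "d = Inf (h2_normsq ` A)"
  have AH: "g \<in> H2" if "g \<in> A" for g
    using that closed_subspace_subset[OF N] by (simp add: A_def)
  have "(\<lambda>n. inverse (f m) * f n) \<in> A"
    using assms by (simp add: A_def closed_subspace_scale)
  then have ne: "h2_normsq ` A \<noteq> {}" by blast
  have bdd: "bdd_below (h2_normsq ` A)"
    by (rule bdd_belowI[of _ 0]) (auto intro: h2_normsq_nonneg AH)
  have dle: "d \<le> h2_normsq g" if "g \<in> A" for g
    unfolding d_def by (rule cInf_lower[OF _ bdd]) (use that in auto)
  have "\<exists>g\<in>A. h2_normsq g < d + 1 / (real k + 1)" for k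
    using cInf_lessD[OF ne, of "d + 1 / (real k + 1)"] by (auto simp: d_def)
  then obtain x where x: "\<And>k. x k \<in> A" "\<And>k. h2_normsq (x k) < d + 1 / (real k + 1)" by metis
  have cauchy: "h2_normsq (\<lambda>n. x k n - x l n) \<le> 4 / (real k + 1)" if "l \<ge> k" for k l
  proof -
    \<comment> \<open>The midpoint again has coefficient one at \<open>m\<close>, so its squared
      norm is at least \<open>d\<close>; the parallelogram law then makes the difference
      small.\<close>
    have "(\<lambda>n. (1/2) * (x k n + x l n)) \<in> A"
      using x(1)[of k] x(1)[of l] closed_subspace_scale[OF N closed_subspace_add[OF N], of "x k" "x l" "1/2"]
      by (auto simp: A_def)
    then have "d \<le> h2_normsq (\<lambda>n. (1/2) * (x k n + x l n))" by (rule dle)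
    also have "\<dots> = (1/4) * h2_normsq (\<lambda>n. x k n + x l n)"
      using h2_normsq_scale[OF H2_add[OF AH[OF x(1)[of k]] AH[OF x(1)[of l]]], of "1/2"]
      by (simp add: power2_eq_square norm_divide)
    finally have "h2_normsq (\<lambda>n. x k n - x l n) \<le> 2 * h2_normsq (x k) + 2 * h2_normsq (x l) - 4 * d"
      using h2_normsq_parallelogram[OF AH[OF x(1)[of k]] AH[OF x(1)[of l]]] by simp
    also have "\<dots> \<le> 2 / (real k + 1) + 2 / (real l + 1)"
      using x(2)[of k] x(2)[of l] by simp
    also have "2 / (real l + 1) \<le> 2 / (real k + 1)"
      using that by (intro divide_left_mono) auto
    finally show ?thesis by simp
  qed
  have "(\<lambda>k. 4 * inverse (real (Suc k))) \<longlonglongrightarrow> 4 * 0"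
    by (intro tendsto_mult_left LIMSEQ_inverse_real_of_nat)
  then have lim0: "(\<lambda>k. 4 / (real k + 1)) \<longlonglongrightarrow> 0"
    by (simp add: divide_inverse add.commute)
  obtain u where u: "u \<in> H2" "(\<lambda>k. h2_norm (\<lambda>n. x k n - u n)) \<longlonglongrightarrow> 0"
    using H2_complete[OF AH[OF x(1)] cauchy lim0] by blast
  have uN: "u \<in> N"
    by (rule closed_subspace_lim[OF N _ u(1) u(2)]) (use x(1) in \<open>auto simp: A_def\<close>)
  have "(\<lambda>k. x k m) \<longlonglongrightarrow> u m"
    by (rule h2_coord_tendsto[OF AH[OF x(1)] u])
  moreover have "(\<lambda>k. x k m) = (\<lambda>k. 1)" using x(1) by (auto simp: A_def)
  ultimately have um: "u m = 1" by (simp add: LIMSEQ_const_iff)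
  have "(\<lambda>k. (h2_norm (x k))\<^sup>2) \<longlonglongrightarrow> (h2_norm u)\<^sup>2"
    by (intro tendsto_power h2_norm_tendsto[OF AH[OF x(1)] u])
  then have lim: "(\<lambda>k. h2_normsq (x k)) \<longlonglongrightarrow> h2_normsq u"
    using u(1) AH[OF x(1)] by (simp add: h2_norm_power2)
  have "(\<lambda>k. d + 1 / (real k + 1)) \<longlonglongrightarrow> d + 0"
    using lim0 by (intro tendsto_add tendsto_const)
      (use tendsto_mult_left[OF lim0, of "1/4"] in simp)
  then have "h2_normsq u \<le> d"
    by (intro LIMSEQ_le[OF lim]) (use x(2) less_imp_le in \<open>auto intro!: exI[of _ 0]\<close>)
  then have min: "h2_normsq u \<le> h2_normsq g" if "g \<in> A" for g
    using dle[OF that] by simp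
  have orth: "h2_inner u w = 0" if w: "w \<in> N" "w m = 0" for w
  proof (cases "h2_normsq w = 0")
    case True
    then show ?thesis using h2_normsq_eq_0 closed_subspace_subset[OF N w(1)] by fastforce
  next
    case False
    have wH: "w \<in> H2" by (rule closed_subspace_subset[OF N w(1)])
    then have pos: "h2_normsq w > 0" using False h2_normsq_nonneg[of w] by simp
    define a where "a = h2_inner u w"
    \<comment> \<open>This \<open>c\<close> minimises the norm of \<open>u + c w\<close>. It lowers
      the squared norm by \<open>|a|^2\<close> over the squared norm of \<open>w\<close>, which
      minimality of \<open>u\<close> allows only for \<open>a = 0\<close>.\<close>
    define c where "c = - a / of_real (h2_normsq w)"
    have "(\<lambda>n. u n + c * w n) \<in> A"
      using uN um w unfolding A_def
      by (auto intro!: closed_subspace_scale[OF N] closed_subspace_add[OF N])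
    from min[OF this] have "0 \<le> h2_normsq (\<lambda>n. c * w n) + 2 * Re (h2_inner u (\<lambda>n. c * w n))"
      using h2_normsq_add[OF u(1) H2_scale[OF wH]] by simp
    also have "h2_inner u (\<lambda>n. c * w n) = cnj c * a"
      unfolding a_def
      using h2_inner_cnj[OF H2_scale[OF wH, of c] u(1)] h2_inner_cnj[OF wH u(1)]
        h2_inner_scale_left[OF wH u(1), of c] by simp
    also have "cnj c * a = of_real (- (cmod a)\<^sup>2 / h2_normsq w)"
      by (simp add: c_def complex_norm_square mult.commute del: of_real_power)
    also have "h2_normsq (\<lambda>n. c * w n) = (cmod a)\<^sup>2 / h2_normsq w"
      unfolding h2_normsq_scale[OF wH] using pos by (simp add: c_def norm_divide power_divide power2_eq_square)
    finally have "(cmod a)\<^sup>2 / h2_normsq w \<le> 0" by simp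
    then have "(cmod a)\<^sup>2 \<le> 0" using pos by (simp add: divide_le_0_iff)
    then show ?thesis by (simp add: a_def)
  qed
  show ?thesis by (rule that[OF uN um orth])
qed

section \<open>The shift and Beurling's theorem\<close>

lemma Mz_funpow: "(Mz ^^ k) x = (\<lambda>n. if n < k then 0 else x (n - k))"
  by (induction k) (auto simp: Mz_def fun_eq_iff)

lemma H2_Mz: "x \<in> H2 \<Longrightarrow> Mz x \<in> H2"
  unfolding H2_def mem_Collect_eq by (subst summable_Suc_iff[symmetric]) (simp add: Mz_def)

lemma H2_Mz_funpow: "x \<in> H2 \<Longrightarrow> (Mz ^^ k) x \<in> H2"
  by (induction k) (auto intro: H2_Mz)

lemma h2_inner_Mz:
  assumes "x \<in> H2" "y \<in> H2"
  shows "h2_inner (Mz x) (Mz y) = h2_inner x y"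
proof -
  have "h2_inner (Mz x) (Mz y) = (\<Sum>n. Mz x (Suc n) * cnj (Mz y (Suc n))) + Mz x 0 * cnj (Mz y 0)"
    unfolding h2_inner_def using suminf_split_head[OF H2_summable_inner[OF H2_Mz[OF assms(1)] H2_Mz[OF assms(2)]]]
    by simp
  then show ?thesis by (simp add: Mz_def h2_inner_def)
qed

lemma h2_inner_Mz_funpow:
  "x \<in> H2 \<Longrightarrow> y \<in> H2 \<Longrightarrow> h2_inner ((Mz ^^ k) x) ((Mz ^^ k) y) = h2_inner x y"
  by (induction k) (auto simp: h2_inner_Mz H2_Mz_funpow)

lemma h2_norm_Mz: "x \<in> H2 \<Longrightarrow> h2_norm (Mz x) = h2_norm x"
  using h2_inner_Mz[of x x] by (simp add: h2_inner_self H2_Mz h2_norm_eq_sqrt)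

lemma Mz_diff: "Mz (\<lambda>n. x n - y n) = (\<lambda>n. Mz x n - Mz y n)"
  by (auto simp: Mz_def)

section \<open>Products of coefficient sequences and inner sequences\<close>

definition trunc :: "nat \<Rightarrow> (nat \<Rightarrow> complex) \<Rightarrow> nat \<Rightarrow> complex" where
  "trunc N f = (\<lambda>n. if n < N then f n else 0)"

lemma H2_trunc: "trunc N f \<in> H2"
  by (rule H2_finite_support[of N]) (simp add: trunc_def)

lemma trunc_tendsto:
  assumes "f \<in> H2"
  shows "(\<lambda>N. h2_norm (\<lambda>n. f n - trunc N f n)) \<longlonglongrightarrow> 0"
proof -
  have s: "summable (\<lambda>n. (cmod (f n))\<^sup>2)" using assms by (simp add: H2_def)
  have "h2_normsq (\<lambda>n. f n - trunc N f n) = h2_normsq f - (\<Sum>n<N. (cmod (f n))\<^sup>2)" for N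
  proof -
    have "(\<lambda>n. f n - trunc N f n) \<in> H2" by (intro H2_diff assms H2_trunc)
    then have "h2_normsq (\<lambda>n. f n - trunc N f n) = (\<Sum>n. (cmod (f (n + N) - trunc N f (n + N)))\<^sup>2)
        + (\<Sum>n<N. (cmod (f n - trunc N f n))\<^sup>2)"
      unfolding h2_normsq_def by (intro suminf_split_initial_segment) (simp add: H2_def)
    also have "\<dots> = (\<Sum>n. (cmod (f (n + N)))\<^sup>2)" by (simp add: trunc_def)
    also have "\<dots> = h2_normsq f - (\<Sum>n<N. (cmod (f n))\<^sup>2)"
      unfolding h2_normsq_def using suminf_split_initial_segment[OF s, of N] by simp
    finally show ?thesis .
  qed
  moreover have "(\<lambda>N. sqrt (h2_normsq f - (\<Sum>n<N. (cmod (f n))\<^sup>2))) \<longlonglongrightarrow> sqrt (h2_normsq f - h2_normsq f)"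
    unfolding h2_normsq_def by (intro tendsto_intros summable_LIMSEQ s)
  ultimately show ?thesis by (simp add: h2_norm_eq_sqrt)
qed

text \<open>The Cauchy product: multiplication of analytic functions, available for coefficients
  before any function on the disc is introduced. \<open>hardy_cprod\<close> makes the link.\<close>

definition cprod :: "(nat \<Rightarrow> complex) \<Rightarrow> (nat \<Rightarrow> complex) \<Rightarrow> nat \<Rightarrow> complex" where
  "cprod u f = (\<lambda>n. \<Sum>k\<le>n. f k * u (n - k))"

lemma cprod_commute: "cprod u f = cprod f u"
proof
  fix n
  show "cprod u f n = cprod f u n"
    unfolding cprod_def
    by (rule sum.reindex_bij_witness[of _ "\<lambda>k. n - k" "\<lambda>k. n - k"]) (auto simp: mult.commute)
qed

text \<open>This connects products with invariance: a polynomial multiple of \<open>u\<close> is a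
  finite combination of shifts of \<open>u\<close>, hence stays in every invariant subspace that
  contains \<open>u\<close>.\<close>

lemma cprod_trunc: "cprod u (trunc N f) = (\<lambda>n. \<Sum>k<N. f k * (Mz ^^ k) u n)"
proof
  fix n
  have "cprod u (trunc N f) n = (\<Sum>k\<in>{..n} \<inter> {..<N}. f k * (Mz ^^ k) u n)"
    unfolding cprod_def by (rule sum.mono_neutral_cong_right) (auto simp: trunc_def Mz_funpow)
  also have "\<dots> = (\<Sum>k<N. f k * (Mz ^^ k) u n)"
    by (rule sum.mono_neutral_left) (auto simp: Mz_funpow)
  finally show "cprod u (trunc N f) n = (\<Sum>k<N. f k * (Mz ^^ k) u n)" .
qed

lemma cprod_diff: "cprod u (\<lambda>n. f n - g n) = (\<lambda>n. cprod u f n - cprod u g n)"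
  by (auto simp: cprod_def left_diff_distrib sum_subtractf)

lemma cprod_scale: "cprod u (\<lambda>n. c * f n) = (\<lambda>n. c * cprod u f n)"
  by (auto simp: cprod_def sum_distrib_left mult.assoc)

lemma cprod_Mz: "cprod u (Mz f) = Mz (cprod u f)"
proof
  fix n
  show "cprod u (Mz f) n = Mz (cprod u f) n"
    by (cases n) (simp_all add: cprod_def Mz_def sum.atMost_Suc_shift del: sum.atMost_Suc)
qed

text \<open>The pairings of \<open>z ^ k u\<close> with \<open>u\<close> are the Fourier
  coefficients of \<open>|u|^2\<close> on the circle, so this expresses \<open>|u| = 1\<close> there
  without mentioning boundary values.\<close>

definition inner_seq :: "(nat \<Rightarrow> complex) \<Rightarrow> bool" where
  "inner_seq u \<longleftrightarrow> u \<in> H2 \<and> h2_normsq u = 1 \<and> (\<forall>k>0. h2_inner ((Mz ^^ k) u) u = 0)"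

text \<open>The shift is isometric, so a common power of \<open>z\<close> cancels and only pairings
  with \<open>u\<close> itself remain.\<close>

lemma inner_seq_orthonormal:
  assumes "inner_seq u"
  shows "h2_inner ((Mz ^^ j) u) ((Mz ^^ k) u) = (if j = k then 1 else 0)"
proof -
  have u: "u \<in> H2" and one: "h2_inner u u = 1" and 0: "\<And>k. k > 0 \<Longrightarrow> h2_inner ((Mz ^^ k) u) u = 0"
    using assms by (auto simp: inner_seq_def h2_inner_self)
  have less: "h2_inner ((Mz ^^ j) u) ((Mz ^^ k) u) = 0" if "k < j" for j k
  proof -
    have "(Mz ^^ j) u = (Mz ^^ k) ((Mz ^^ (j - k)) u)"
      using that by (metis comp_apply funpow_add le_add_diff_inverse less_imp_le_nat)
    then show ?thesis
      using that by (simp add: h2_inner_Mz_funpow H2_Mz_funpow u 0)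
  qed
  consider "j = k" | "k < j" | "j < k" by linarith
  then show ?thesis
  proof cases
    case 1
    then show ?thesis by (simp add: h2_inner_Mz_funpow u one)
  next
    case 2
    then show ?thesis by (simp add: less)
  next
    case 3
    then show ?thesis
      using less[OF 3] h2_inner_cnj[of "(Mz ^^ k) u" "(Mz ^^ j) u"] by (simp add: H2_Mz_funpow u)
  qed
qed

text \<open>Pythagoras for the orthonormal system \<open>z ^ k u\<close>.\<close>

lemma h2_normsq_cprod_trunc:
  assumes "inner_seq u"
  shows "h2_normsq (cprod u (trunc N f)) = (\<Sum>k<N. (cmod (f k))\<^sup>2)"
proof -
  let ?s = "\<lambda>N n. \<Sum>k<N. f k * (Mz ^^ k) u n"
  have e: "(Mz ^^ k) u \<in> H2" for k
    using assms by (simp add: inner_seq_def H2_Mz_funpow)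
  have s: "?s N \<in> H2" for N by (intro H2_sum e)
  have "h2_inner (?s N) (?s N) = (\<Sum>k<N. of_real ((cmod (f k))\<^sup>2))"
  proof -
    have "h2_inner (?s N) (?s N) = (\<Sum>k<N. f k * h2_inner ((Mz ^^ k) u) (?s N))"
      by (rule h2_inner_sum_left[OF e s])
    also have "\<dots> = (\<Sum>k<N. f k * cnj (f k))"
    proof (rule sum.cong[OF refl])
      fix k assume k: "k \<in> {..<N}"
      have "h2_inner (?s N) ((Mz ^^ k) u) = (\<Sum>j<N. f j * h2_inner ((Mz ^^ j) u) ((Mz ^^ k) u))"
        by (rule h2_inner_sum_left[OF e e])
      also have "\<dots> = (\<Sum>j<N. if j = k then f k else 0)"
        by (intro sum.cong) (auto simp: inner_seq_orthonormal[OF assms])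
      also have "\<dots> = f k" using k by simp
      finally show "f k * h2_inner ((Mz ^^ k) u) (?s N) = f k * cnj (f k)"
        using h2_inner_cnj[OF s[of N] e[of k]] by simp
    qed
    finally show ?thesis by (simp only: complex_norm_square)
  qed
  then have "complex_of_real (h2_normsq (?s N)) = of_real (\<Sum>k<N. (cmod (f k))\<^sup>2)"
    by (simp add: h2_inner_self s)
  then show ?thesis
    unfolding cprod_trunc of_real_eq_iff .
qed

text \<open>The first \<open>K\<close> coefficients of \<open>u f\<close> depend only on the first
  \<open>K\<close> of \<open>f\<close>. The polynomial case therefore bounds each finite section
  before \<open>u f\<close> is known to lie in \<open>H2\<close>.\<close>

lemma inner_seq_contraction:
  assumes "inner_seq u" "f \<in> H2"
  shows "cprod u f \<in> H2" "h2_normsq (cprod u f) \<le> h2_normsq f"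
proof -
  have "(\<Sum>n<K. (cmod (cprod u f n))\<^sup>2) \<le> h2_normsq f" for K
  proof -
    have H: "cprod u (trunc K f) \<in> H2"
      unfolding cprod_trunc using assms by (intro H2_sum H2_Mz_funpow) (simp add: inner_seq_def)
    have "(\<Sum>n<K. (cmod (cprod u f n))\<^sup>2) = (\<Sum>n<K. (cmod (cprod u (trunc K f) n))\<^sup>2)"
      by (intro sum.cong) (auto simp: cprod_def trunc_def)
    also have "\<dots> \<le> h2_normsq (cprod u (trunc K f))" by (rule sum_le_h2_normsq[OF H]) simp
    also have "\<dots> \<le> h2_normsq f"
      unfolding h2_normsq_cprod_trunc[OF assms(1)] by (rule sum_le_h2_normsq[OF assms(2)]) simp
    finally show ?thesis .
  qed
  from H2_normsq_leI[OF this] show "cprod u f \<in> H2" "h2_normsq (cprod u f) \<le> h2_normsq f" by auto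
qed

lemma inner_seq_h2_norm_diff_le:
  assumes "inner_seq u" "f \<in> H2" "g \<in> H2"
  shows "h2_norm (\<lambda>n. cprod u f n - cprod u g n) \<le> h2_norm (\<lambda>n. f n - g n)"
  using inner_seq_contraction(2)[OF assms(1) H2_diff[OF assms(2,3)]]
  by (simp add: cprod_diff h2_norm_eq_sqrt)

lemma cprod_trunc_tendsto:
  assumes "inner_seq u" "f \<in> H2"
  shows "(\<lambda>N. h2_norm (\<lambda>n. cprod u (trunc N f) n - cprod u f n)) \<longlonglongrightarrow> 0"
proof (rule Lim_null_comparison[OF _ trunc_tendsto[OF assms(2)]])
  have "norm (h2_norm (\<lambda>n. cprod u (trunc N f) n - cprod u f n)) \<le> h2_norm (\<lambda>n. f n - trunc N f n)" for N
    using inner_seq_h2_norm_diff_le[OF assms H2_trunc, of N f] h2_norm_minus_commute[of "cprod u (trunc N f)" "cprod u f"]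
      h2_norm_nonneg[OF H2_diff[OF inner_seq_contraction(1)[OF assms] inner_seq_contraction(1)[OF assms(1) H2_trunc[of N f]]]]
    by simp
  then show "\<forall>\<^sub>F N in sequentially. norm (h2_norm (\<lambda>n. cprod u (trunc N f) n - cprod u f n)) \<le> h2_norm (\<lambda>n. f n - trunc N f n)"
    by simp
qed

lemma h2_normsq_cprod:
  assumes "inner_seq u" "f \<in> H2"
  shows "h2_normsq (cprod u f) = h2_normsq f"
proof -
  have "(\<lambda>N. (h2_norm (cprod u (trunc N f)))\<^sup>2) \<longlonglongrightarrow> (h2_norm (cprod u f))\<^sup>2"
    by (intro tendsto_power h2_norm_tendsto cprod_trunc_tendsto inner_seq_contraction assms H2_trunc)
  then have "(\<lambda>N. h2_normsq (cprod u (trunc N f))) \<longlonglongrightarrow> h2_normsq (cprod u f)"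
    by (simp add: h2_norm_power2 inner_seq_contraction assms H2_trunc)
  moreover have "(\<lambda>N. h2_normsq (cprod u (trunc N f))) \<longlonglongrightarrow> h2_normsq f"
    unfolding h2_normsq_cprod_trunc[OF assms(1)] using sums_h2_normsq[OF assms(2)] by (simp add: sums_def)
  ultimately show ?thesis by (rule LIMSEQ_unique)
qed

text \<open>Reduces every orthogonality claim about \<open>u f\<close> to the vectors
  \<open>z ^ k u\<close>.\<close>

lemma h2_inner_cprod_tendsto:
  assumes "inner_seq u" "f \<in> H2" "y \<in> H2"
  shows "(\<lambda>N. \<Sum>k<N. f k * h2_inner ((Mz ^^ k) u) y) \<longlonglongrightarrow> h2_inner (cprod u f) y"
proof -
  have "(\<lambda>N. h2_inner (cprod u (trunc N f)) y) \<longlonglongrightarrow> h2_inner (cprod u f) y"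
    by (intro h2_inner_tendsto_left cprod_trunc_tendsto inner_seq_contraction assms H2_trunc)
  then show ?thesis
    using assms by (simp add: cprod_trunc h2_inner_sum_left H2_Mz_funpow inner_seq_def)
qed

text \<open>The coefficients of \<open>f\<close> are the Fourier coefficients of \<open>u f\<close>
  in the system \<open>z ^ j u\<close>. This serves the residual in Beurling's theorem and the
  pairing that fixes the linear polynomial.\<close>

lemma h2_inner_cprod_shift:
  assumes "inner_seq u" "f \<in> H2"
  shows "h2_inner (cprod u f) ((Mz ^^ j) u) = f j"
proof -
  have "(\<lambda>N. \<Sum>k<N. f k * h2_inner ((Mz ^^ k) u) ((Mz ^^ j) u)) \<longlonglongrightarrow> h2_inner (cprod u f) ((Mz ^^ j) u)"
    using assms by (intro h2_inner_cprod_tendsto H2_Mz_funpow) (auto simp: inner_seq_def)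
  moreover have "(\<lambda>N. \<Sum>k<N. f k * h2_inner ((Mz ^^ k) u) ((Mz ^^ j) u)) \<longlonglongrightarrow> f j"
  proof (rule tendsto_eventually)
    show "\<forall>\<^sub>F N in sequentially. (\<Sum>k<N. f k * h2_inner ((Mz ^^ k) u) ((Mz ^^ j) u)) = f j"
      using eventually_gt_at_top[of j]
    proof eventually_elim
      case (elim N)
      have "(\<Sum>k<N. f k * h2_inner ((Mz ^^ k) u) ((Mz ^^ j) u)) = (\<Sum>k<N. if k = j then f j else 0)"
        by (intro sum.cong) (auto simp: inner_seq_orthonormal[OF assms(1)])
      then show ?case using elim by simp
    qed
  qed
  ultimately show ?thesis by (rule LIMSEQ_unique)
qed

definition shift_invariant :: "(nat \<Rightarrow> complex) set \<Rightarrow> bool" where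
  "shift_invariant N \<longleftrightarrow> (\<forall>x\<in>N. Mz x \<in> N)"

lemma shift_invariant_funpow: "shift_invariant N \<Longrightarrow> x \<in> N \<Longrightarrow> (Mz ^^ k) x \<in> N"
  by (induction k) (auto simp: shift_invariant_def)

lemma cprod_in_shift_invariant:
  assumes "closed_subspace N" "shift_invariant N" "inner_seq u" "u \<in> N" "f \<in> H2"
  shows "cprod u f \<in> N"
proof (rule closed_subspace_lim[OF assms(1)])
  show "cprod u (trunc k f) \<in> N" for k
    unfolding cprod_trunc using assms by (intro closed_subspace_sum shift_invariant_funpow)
qed (auto intro: cprod_trunc_tendsto inner_seq_contraction assms)

text \<open>Let \<open>m\<close> be the least order of vanishing at the origin in \<open>N\<close>.
  Every \<open>z w\<close> with \<open>w\<close> in \<open>N\<close> has zero coefficient at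
  \<open>m\<close>, so the extremal vector for that coefficient is orthogonal to \<open>z N\<close>.
  No projection onto the complement of \<open>z N\<close> is constructed.\<close>

lemma wandering_inner_seq:
  assumes N: "closed_subspace N" "shift_invariant N" and ne: "N \<noteq> {\<lambda>n. 0}"
  obtains u where "u \<in> N" "inner_seq u" "\<And>w. w \<in> N \<Longrightarrow> h2_inner (Mz w) u = 0"
proof -
  have "\<exists>f\<in>N. \<exists>m. f m \<noteq> 0"
    using ne closed_subspace_zero[OF N(1)] by fastforce
  then have ex: "\<exists>m. \<exists>f\<in>N. f m \<noteq> 0" by blast
  define m where "m = (LEAST m. \<exists>f\<in>N. f m \<noteq> 0)"
  obtain f where f: "f \<in> N" "f m \<noteq> 0"
    using LeastI_ex[OF ex] by (auto simp: m_def)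
  have low: "g k = 0" if "g \<in> N" "k < m" for g k
    using not_less_Least[of k "\<lambda>m. \<exists>f\<in>N. f m \<noteq> 0"] that by (auto simp: m_def)
  obtain v where v: "v \<in> N" "v m = 1" "\<And>w. w \<in> N \<Longrightarrow> w m = 0 \<Longrightarrow> h2_inner v w = 0"
    using extremal_vector[where m=m, OF N(1) f] by blast
  have vH: "v \<in> H2" using closed_subspace_subset[OF N(1) v(1)] .
  have vpos: "h2_normsq v > 0"
    using h2_normsq_nonneg[OF vH] h2_normsq_eq_0[OF vH] v(2) by (cases "h2_normsq v = 0") auto
  define u where "u = (\<lambda>n. of_real (1 / sqrt (h2_normsq v)) * v n)"
  have uN: "u \<in> N" unfolding u_def by (rule closed_subspace_scale[OF N(1) v(1)])
  have uH: "u \<in> H2" using closed_subspace_subset[OF N(1) uN] .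
  have orth: "h2_inner (Mz w) u = 0" if "w \<in> N" for w
  proof -
    have MN: "Mz w \<in> N" using that N(2) by (simp add: shift_invariant_def)
    have MH: "Mz w \<in> H2" using closed_subspace_subset[OF N(1) MN] .
    have "Mz w m = 0" using low[OF that] by (cases m) (auto simp: Mz_def)
    then have "h2_inner v (Mz w) = 0" using v(3) MN by blast
    then have "h2_inner u (Mz w) = 0"
      unfolding u_def by (simp only: h2_inner_scale_left[OF vH MH] mult_zero_right)
    then show ?thesis using h2_inner_cnj[OF uH MH] by simp
  qed
  have "inner_seq u"
    unfolding inner_seq_def
  proof (intro conjI allI impI)
    show "u \<in> H2" by fact
    show "h2_normsq u = 1"
      unfolding u_def using vpos by (subst h2_normsq_scale[OF vH]) (simp add: norm_divide power_divide)
    fix k :: nat assume "k > 0"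
    then obtain j where "k = Suc j" by (cases k) auto
    then show "h2_inner ((Mz ^^ k) u) u = 0"
      using orth[OF shift_invariant_funpow[OF N(2) uN, of j]] by simp
  qed
  then show ?thesis using that uN orth by blast
qed

text \<open>If the part \<open>K\<close> of \<open>N\<close> orthogonal to all \<open>z ^ k u\<close> were nonzero, it would contain an inner \<open>v\<close>, and
  \<open>u v\<close>, approximated both by polynomial multiples of \<open>u\<close> and of \<open>v\<close>, would be orthogonal to itself.\<close>
theorem Beurling:
  assumes N: "closed_subspace N" "shift_invariant N" and ne: "N \<noteq> {\<lambda>n. 0}"
  obtains u where "inner_seq u" "N = cprod u ` H2"
proof -
  obtain u where u: "u \<in> N" "inner_seq u" "\<And>w. w \<in> N \<Longrightarrow> h2_inner (Mz w) u = 0"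
    using wandering_inner_seq[OF assms] by blast
  have NH: "x \<in> H2" if "x \<in> N" for x using closed_subspace_subset[OF N(1) that] .
  have uk: "(Mz ^^ k) u \<in> H2" for k using u(1) by (intro H2_Mz_funpow NH)
  define K where "K = {f \<in> N. \<forall>k. h2_inner f ((Mz ^^ k) u) = 0}"
  have K: "closed_subspace K"
    unfolding closed_subspace_def h2_closed_def
  proof (intro conjI ballI allI impI; (elim conjE)?)
    show "K \<subseteq> H2" using NH by (auto simp: K_def)
    show "(\<lambda>n. 0) \<in> K" using closed_subspace_zero[OF N(1)] by (simp add: K_def)
    show "(\<lambda>n. x n + y n) \<in> K" if "x \<in> K" "y \<in> K" for x y
      using that by (simp add: K_def closed_subspace_add[OF N(1)] h2_inner_add_left NH uk)
    show "(\<lambda>n. c * x n) \<in> K" if "x \<in> K" for c x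
      using that by (simp add: K_def closed_subspace_scale[OF N(1)] h2_inner_scale_left NH uk)
    fix x y assume x: "\<forall>k. x k \<in> K" and y: "y \<in> H2" and l: "(\<lambda>k. h2_norm (\<lambda>n. x k n - y n)) \<longlonglongrightarrow> 0"
    have "y \<in> N" by (rule closed_subspace_lim[OF N(1) _ y l]) (use x in \<open>auto simp: K_def\<close>)
    moreover have "h2_inner y ((Mz ^^ j) u) = 0" for j
    proof -
      have "(\<lambda>k. h2_inner (x k) ((Mz ^^ j) u)) \<longlonglongrightarrow> h2_inner y ((Mz ^^ j) u)"
        by (rule h2_inner_tendsto_left[OF _ y uk l]) (use x NH in \<open>auto simp: K_def\<close>)
      then show ?thesis using x by (simp add: K_def LIMSEQ_const_iff)
    qed
    ultimately show "y \<in> K" by (simp add: K_def)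
  qed
  have Kinv: "shift_invariant K"
    unfolding shift_invariant_def
  proof
    fix x assume x: "x \<in> K"
    then have xN: "x \<in> N" by (simp add: K_def)
    have "h2_inner (Mz x) ((Mz ^^ k) u) = 0" for k
      using x by (cases k) (auto simp: u(3) K_def h2_inner_Mz NH uk)
    then show "Mz x \<in> K" using xN N(2) by (simp add: K_def shift_invariant_def)
  qed
  have "K = {\<lambda>n. 0}"
  proof (rule ccontr)
    assume "K \<noteq> {\<lambda>n. 0}"
    then obtain v where v: "v \<in> K" "inner_seq v"
      by (rule wandering_inner_seq[OF K Kinv])
    have vH: "v \<in> H2" and uH: "u \<in> H2" using v u(1) NH by (auto simp: K_def)
    let ?w = "cprod u v"
    have w: "?w = cprod v u" by (rule cprod_commute)
    have wH: "?w \<in> H2" using inner_seq_contraction(1)[OF u(2) vH] .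
    have vk: "(Mz ^^ j) v \<in> H2" for j by (rule H2_Mz_funpow[OF vH])
    have 1: "h2_inner ((Mz ^^ j) v) ((Mz ^^ k) u) = 0" for j k
      using shift_invariant_funpow[OF Kinv v(1), of j] by (simp add: K_def)
    have 2: "h2_inner ?w ((Mz ^^ k) u) = 0" for k
      using h2_inner_cprod_tendsto[OF v(2) uH uk, of k] 1 by (simp add: w LIMSEQ_const_iff)
    have "h2_inner ((Mz ^^ k) u) ?w = 0" for k
      using 2[of k] h2_inner_cnj[OF wH uk] by simp
    then have "h2_inner ?w ?w = 0"
      using h2_inner_cprod_tendsto[OF u(2) vH wH] by (simp add: LIMSEQ_const_iff)
    then have "h2_normsq ?w = 0" by (simp add: h2_inner_self wH)
    then show False using h2_normsq_cprod[OF u(2) vH] v(2) by (simp add: inner_seq_def)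
  qed
  have "N \<subseteq> cprod u ` H2"
  proof
    fix f assume f: "f \<in> N"
    have fH: "f \<in> H2" by (rule NH[OF f])
    define c where "c = (\<lambda>k. h2_inner f ((Mz ^^ k) u))"
    \<comment> \<open>Bessel's inequality, from the nonnegative squared norm of \<open>f\<close>
      minus its partial expansion. It puts \<open>c\<close> into \<open>H2\<close>, so that
      \<open>u c\<close> makes sense and the residual can be tested for membership in
      \<open>K\<close>.\<close>
    have "(\<Sum>k<m. (cmod (c k))\<^sup>2) \<le> h2_normsq f" for m
    proof -
      let ?s = "cprod u (trunc m c)"
      have sH: "?s \<in> H2" by (rule inner_seq_contraction(1)[OF u(2) H2_trunc])
      have "h2_inner ?s f = (\<Sum>k<m. c k * cnj (c k))"
        unfolding cprod_trunc using h2_inner_cnj[OF fH uk]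
        by (subst h2_inner_sum_left[OF uk fH]) (simp add: c_def)
      then have r: "h2_inner ?s f = of_real (h2_normsq ?s)"
        by (simp only: h2_normsq_cprod_trunc[OF u(2)] complex_norm_square of_real_sum)
      have "h2_inner (\<lambda>n. -1 * ?s n) f = of_real (- h2_normsq ?s)"
        using h2_inner_scale_left[OF sH fH, of "-1"] r by simp
      then have "h2_normsq (\<lambda>n. -1 * ?s n + f n) = h2_normsq f - h2_normsq ?s"
        using h2_normsq_add[OF H2_scale[OF sH, of "-1"] fH] h2_normsq_scale[OF sH, of "-1"] by simp
      then have "h2_normsq ?s \<le> h2_normsq f"
        using h2_normsq_nonneg[OF H2_add[OF H2_scale[OF sH, of "-1"] fH]] by simp
      then show ?thesis by (simp add: h2_normsq_cprod_trunc[OF u(2)])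
    qed
    then have cH: "c \<in> H2" by (rule H2_normsq_leI)
    have "(\<lambda>n. f n - cprod u c n) \<in> K"
      unfolding K_def
    proof (intro CollectI conjI allI)
      show "(\<lambda>n. f n - cprod u c n) \<in> N"
        by (intro closed_subspace_diff[OF N(1)] f cprod_in_shift_invariant[OF N u(2,1) cH])
      show "h2_inner (\<lambda>n. f n - cprod u c n) ((Mz ^^ k) u) = 0" for k
        using h2_inner_diff_left[OF fH inner_seq_contraction(1)[OF u(2) cH] uk]
        by (simp add: h2_inner_cprod_shift[OF u(2) cH]) (simp add: c_def)
    qed
    then have "f = cprod u c"
      using \<open>K = {\<lambda>n. 0}\<close> by (simp add: fun_eq_iff)
    then show "f \<in> cprod u ` H2" using cH by blast
  qed
  moreover have "cprod u ` H2 \<subseteq> N"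
    using cprod_in_shift_invariant[OF N u(2,1)] by blast
  ultimately show ?thesis using that u(2) by blast
qed

section \<open>Boundary derivatives and radial limits\<close>

text \<open>Conjugation followed by multiplication with the unimodular \<open>z0 * z\<close>
  exchanges the two differences. It yields the distance from a circle point to the reflection of
  \<open>r z0\<close>.\<close>

lemma cmod_reflect:
  assumes "cmod z = 1" "cmod z0 = 1"
  shows "cmod (z0 - of_real r * z) = cmod (z - of_real r * z0)"
proof -
  have 1: "z * cnj z = 1" "z0 * cnj z0 = 1"
    using assms by (simp_all flip: complex_norm_square)
  have "z0 * z * cnj (z - of_real r * z0) = z0 * (z * cnj z) - of_real r * z * (z0 * cnj z0)"
    by (simp add: algebra_simps)
  also have "\<dots> = z0 - of_real r * z" by (simp add: 1)
  finally have "cmod (z0 - of_real r * z) = cmod (z0 * z * cnj (z - of_real r * z0))" by simp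
  then show ?thesis by (simp only: norm_mult assms complex_mod_cnj mult_1_left)
qed

text \<open>Both poles are at comparable distance from \<open>z\<close> (\<open>s\<close> and
  \<open>s / r\<close>) and at distance \<open>O(1 - r)\<close> from each other, so the difference
  of the kernels gains a factor \<open>(1 - r) / s\<close>. The constant is \<open>4 * 3\<close>:
  \<open>|w - w'| <= 4 (1 - r)\<close> and \<open>s + s / r <= 3 s\<close>, both from
  \<open>r >= 1/2\<close>.\<close>

lemma conjugate_kernel_bound:
  fixes z z0 :: complex and r :: real
  assumes z: "cmod z = 1" "cmod z0 = 1" and r: "1/2 \<le> r" "r < 1"
  defines "w \<equiv> of_real r * z0" and "w' \<equiv> z0 / of_real r"
  shows "cmod (1 / (z - w)\<^sup>2 - 1 / (z - w')\<^sup>2) \<le> 12 * (1 - r) / cmod (z - w) ^ 3"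
proof -
  define s where "s = cmod (z - w)"
  have nw: "cmod w = r" using z r by (simp add: w_def norm_mult)
  have spos: "s > 0"
    using nw z r by (auto simp: s_def)
  have "z - w' = (-1 / of_real r) * (z0 - of_real r * z)"
    using r by (simp add: w'_def field_simps)
  then have s': "cmod (z - w') = s / r"
    using cmod_reflect[OF z, of r] r by (simp add: norm_mult norm_divide s_def w_def)
  have s'pos: "cmod (z - w') > 0" using s' spos r by simp
  have sle: "s \<le> s / r" using r spos by (simp add: field_simps)
  have "s * (1 + 1 / r) \<le> s * 3"
    using r spos by (intro mult_left_mono) (auto simp: field_simps)
  then have three: "s + s / r \<le> 3 * s" by (simp add: algebra_simps)
  have ww: "cmod (w - w') \<le> 4 * (1 - r)"
  proof -
    have "w - w' = of_real (r - 1 / r) * z0" by (simp add: w_def w'_def algebra_simps)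
    then have "cmod (w - w') = \<bar>r - 1 / r\<bar>" by (simp only: norm_mult z norm_of_real mult_1_right)
    also have "\<dots> = (1 - r) * ((1 + r) / r)"
    proof -
      have "r * r < 1" using r mult_strict_mono[of r 1 r 1] by simp
      then show ?thesis using r by (simp add: field_simps abs_if)
    qed
    also have "\<dots> \<le> (1 - r) * 4" using r by (intro mult_left_mono) (auto simp: field_simps)
    finally show ?thesis by simp
  qed
  have "1 / (z - w)\<^sup>2 - 1 / (z - w')\<^sup>2 = (w - w') * ((z - w) + (z - w')) / ((z - w)\<^sup>2 * (z - w')\<^sup>2)"
  proof -
    have "(z - w) \<noteq> 0" "(z - w') \<noteq> 0" using spos s'pos by (auto simp: s_def)
    then show ?thesis by (simp add: divide_simps) (simp add: algebra_simps power2_eq_square)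
  qed
  then have "cmod (1 / (z - w)\<^sup>2 - 1 / (z - w')\<^sup>2) =
      cmod (w - w') * cmod ((z - w) + (z - w')) / (s\<^sup>2 * (s / r)\<^sup>2)"
    by (simp add: norm_mult norm_divide norm_power s' s_def del: add_diff_eq)
  also have "\<dots> \<le> (4 * (1 - r)) * (3 * s) / (s\<^sup>2 * s\<^sup>2)"
  proof (rule frac_le)
    show "cmod (w - w') * cmod (z - w + (z - w')) \<le> 4 * (1 - r) * (3 * s)"
      using ww norm_triangle_ineq[of "z - w" "z - w'"] three r spos
      by (intro mult_mono) (auto simp: s' s_def[symmetric])
    show "s\<^sup>2 * s\<^sup>2 \<le> s\<^sup>2 * (s / r)\<^sup>2"
      using sle spos by (intro mult_left_mono power_mono) auto
  qed (use r spos in auto)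
  also have "\<dots> = 12 * (1 - r) / s ^ 3"
    using spos by (simp add: power2_eq_square power3_eq_cube)
  finally show ?thesis by (simp add: s_def)
qed

lemma vector_derivative_unit_circlepath:
  "vector_derivative (circlepath 0 1) (at t) = 2 * of_real pi * \<i> * circlepath 0 1 t"
  by (subst vector_derivative_circlepath) (simp add: circlepath)

lemma norm_unit_circlepath: "cmod (circlepath 0 1 t) = 1"
  by (simp add: circlepath norm_mult)

text \<open>Cauchy's formula at \<open>w\<close> for \<open>1 / (1 - cnj w * u)\<close>, which is
  holomorphic near the closed disc. On the circle \<open>1 - cnj w * u = u * cnj (u - w)\<close>,
  and this turns the integrand into the real kernel.\<close>

lemma Poisson_kernel_has_integral:
  assumes "cmod w < 1"
  shows "((\<lambda>t. 1 / (cmod (circlepath 0 1 t - w))\<^sup>2) has_integral 1 / (1 - (cmod w)\<^sup>2)) {0..1}"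
proof -
  let ?g = "circlepath 0 1"
  have nz: "1 - cnj w * u \<noteq> 0" if "cmod u \<le> 1" for u
  proof
    assume "1 - cnj w * u = 0"
    then have "cmod w * cmod u = 1"
      by (metis complex_mod_cnj eq_iff_diff_eq_0 norm_mult norm_one)
    moreover have "cmod w * cmod u \<le> cmod w * 1" using that by (intro mult_left_mono) auto
    ultimately show False using assms by simp
  qed
  have "((\<lambda>u. (1 / (1 - cnj w * u)) / (u - w)) has_contour_integral
      (2 * of_real pi * \<i> * (1 / (1 - cnj w * w)))) ?g"
    by (rule Cauchy_integral_circlepath)
      (use assms nz in \<open>auto intro!: continuous_intros holomorphic_intros\<close>)
  then have "((\<lambda>t. (1 / (1 - cnj w * ?g t)) / (?g t - w) * (2 * of_real pi * \<i> * ?g t)) has_integral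
      (2 * of_real pi * \<i> * (1 / (1 - cnj w * w)))) {0..1}"
    unfolding has_contour_integral vector_derivative_unit_circlepath .
  from has_integral_divide[OF this, of "2 * of_real pi * \<i>"]
  have "((\<lambda>t. ?g t / ((1 - cnj w * ?g t) * (?g t - w))) has_integral (1 / (1 - cnj w * w))) {0..1}"
  proof (rule has_integral_eq_rhs[OF has_integral_cong[THEN iffD1, rotated]])
    show "1 / (1 - cnj w * ?g t) / (?g t - w) * (2 * of_real pi * \<i> * ?g t) / (2 * of_real pi * \<i>)
        = ?g t / ((1 - cnj w * ?g t) * (?g t - w))" for t
      by (simp only: times_divide_eq_left times_divide_eq_right divide_divide_eq_left mult_1_left) (simp add: mult.commute)
  qed simp
  moreover have "?g t / ((1 - cnj w * ?g t) * (?g t - w)) = of_real (1 / (cmod (?g t - w))\<^sup>2)" for t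
  proof -
    have 1: "?g t * cnj (?g t) = 1"
      using norm_unit_circlepath[of t] by (simp flip: complex_norm_square)
    then have nz: "?g t \<noteq> 0" by auto
    have "1 - cnj w * ?g t = ?g t * cnj (?g t - w)"
      using 1 by (simp add: algebra_simps)
    then have "?g t / ((1 - cnj w * ?g t) * (?g t - w)) = 1 / ((?g t - w) * cnj (?g t - w))"
      using nz by simp
    then show ?thesis by (simp only: complex_norm_square[symmetric]) simp
  qed
  moreover have "1 / (1 - cnj w * w) = of_real (1 / (1 - (cmod w)\<^sup>2))"
    by (simp add: complex_norm_square mult.commute del: of_real_power)
  ultimately have "((\<lambda>t. complex_of_real (1 / (cmod (?g t - w))\<^sup>2)) has_integral of_real (1 / (1 - (cmod w)\<^sup>2))) {0..1}"
    by simp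
  from has_integral_Re[OF this] show ?thesis by simp
qed

text \<open>The Cauchy kernel alone is too large by a logarithm for this estimate. Subtracting the
  kernel at the reflected point \<open>1 / cnj w\<close> does not change the integral and gains the missing factor.\<close>
lemma radial_derivative_estimate:
  fixes E :: "complex \<Rightarrow> complex"
  assumes cont: "continuous_on (cball 0 1) E" and hol: "E holomorphic_on ball 0 1"
    and z0: "cmod z0 = 1" and r: "1/2 \<le> r" "r < 1" and nn: "0 \<le> \<epsilon>" "0 \<le> C"
    and bd: "\<And>z. cmod z = 1 \<Longrightarrow> cmod (E z) \<le> \<epsilon> * cmod (z - z0) + C * cmod (z - z0) ^ 3"
  shows "cmod (deriv E (of_real r * z0)) \<le> 24 * \<epsilon> + 96 * C * (1 - r)"
proof -
  let ?g = "circlepath 0 1"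
  define w where "w = of_real r * z0"
  define w' where "w' = z0 / of_real r"
  define k where "k = (\<lambda>u. 1 / (u - w)\<^sup>2 - 1 / (u - w')\<^sup>2)"
  have nw: "cmod w = r" using z0 r by (simp add: w_def norm_mult)
  have nw': "cmod w' > 1" using z0 r by (simp add: w'_def norm_divide)
  have "((\<lambda>u. E u / (u - w) ^ Suc 1) has_contour_integral ((2 * pi * \<i>) / (fact 1) * (deriv ^^ 1) E w)) ?g"
    by (rule Cauchy_has_contour_integral_higher_derivative_circlepath[OF cont hol])
      (use nw r in simp)
  then have 1: "((\<lambda>u. E u / (u - w)\<^sup>2) has_contour_integral (2 * pi * \<i> * deriv E w)) ?g"
    by (simp add: power2_eq_square)
  have ne: "u - w' \<noteq> 0" if "cmod u \<le> 1" for u using that nw' by auto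
  have 2: "((\<lambda>u. E u / (u - w')\<^sup>2) has_contour_integral 0) ?g"
  proof (rule Cauchy_theorem_disc[of "{}" 0 1])
    show "continuous_on (cball 0 1) (\<lambda>u. E u / (u - w')\<^sup>2)"
      using ne by (auto intro!: continuous_intros cont)
    have "(\<lambda>u. E u / (u - w')\<^sup>2) holomorphic_on ball 0 1"
      using ne by (auto intro!: holomorphic_intros hol)
    then show "(\<lambda>u. E u / (u - w')\<^sup>2) field_differentiable at x" if "x \<in> ball 0 1 - {}" for x
      using that by (auto simp: holomorphic_on_open field_differentiable_def)
  qed (auto simp: sphere_def)
  have "((\<lambda>u. E u * k u) has_contour_integral (2 * pi * \<i> * deriv E w)) ?g"
    using has_contour_integral_diff[OF 1 2] by (simp add: k_def right_diff_distrib)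
  then have I: "((\<lambda>t. E (?g t) * k (?g t) * (2 * of_real pi * \<i> * ?g t)) has_integral (2 * pi * \<i> * deriv E w)) {0..1}"
    unfolding has_contour_integral vector_derivative_unit_circlepath .
  \<comment> \<open>With \<open>s\<close> the distance to \<open>w\<close>,
    \<open>|z - z0| <= 2 s\<close>, so \<open>E\<close> is at most
    \<open>2 \<epsilon> s + 8 C s ^ 3\<close>. Multiplying by the kernel bound
    \<open>12 (1 - r) / s ^ 3\<close> gives the constants 24 and 96; the cube in the hypothesis is
    there to cancel \<open>s ^ 3\<close>. The factor \<open>2 * pi\<close> is the speed of the
    parametrisation.\<close>
  let ?b = "\<lambda>t. 2 * pi * (24 * \<epsilon> * (1 - r) * (1 / (cmod (?g t - w))\<^sup>2) + 96 * C * (1 - r))"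
  have "((\<lambda>t. 24 * \<epsilon> * (1 - r) * (1 / (cmod (?g t - w))\<^sup>2)) has_integral 24 * \<epsilon> * (1 - r) * (1 / (1 - r\<^sup>2))) {0..1}"
    using Poisson_kernel_has_integral[of w] nw r by (intro has_integral_mult_right) auto
  from has_integral_mult_right[OF has_integral_add[OF this has_integral_const_real[of "96 * C * (1 - r)" 0 1]], of "2 * pi"]
  have B: "(?b has_integral 2 * pi * (24 * \<epsilon> * (1 - r) * (1 / (1 - r\<^sup>2)) + 96 * C * (1 - r))) {0..1}"
    by simp
  have bound: "norm (E (?g t) * k (?g t) * (2 * of_real pi * \<i> * ?g t)) \<le> ?b t" for t
  proof -
    let ?z = "?g t"
    define s where "s = cmod (?z - w)"
    have z1: "cmod ?z = 1" by (rule norm_unit_circlepath)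
    have spos: "s > 0" using nw z1 r by (auto simp: s_def)
    have "cmod ?z \<le> cmod (?z - w) + cmod w" by (metis diff_add_cancel norm_triangle_ineq)
    then have "1 - r \<le> s" using z1 nw by (simp add: s_def)
    moreover have "cmod (w - z0) = 1 - r"
    proof -
      have "w - z0 = of_real (r - 1) * z0" by (simp add: w_def algebra_simps)
      then show ?thesis using r z0 by (simp only: norm_mult norm_of_real) simp
    qed
    moreover have "cmod (?z - z0) \<le> s + cmod (w - z0)"
      unfolding s_def by (metis add_diff_eq diff_add_cancel norm_triangle_ineq)
    ultimately have d: "cmod (?z - z0) \<le> 2 * s" by simp
    have "cmod (E ?z) \<le> \<epsilon> * cmod (?z - z0) + C * cmod (?z - z0) ^ 3" by (rule bd[OF z1])
    also have "\<dots> \<le> \<epsilon> * (2 * s) + C * (2 * s) ^ 3"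
      using d nn by (intro add_mono mult_left_mono power_mono) auto
    finally have Eb: "cmod (E ?z) \<le> \<epsilon> * (2 * s) + C * (2 * s) ^ 3" .
    have kb: "cmod (k ?z) \<le> 12 * (1 - r) / s ^ 3"
      using conjugate_kernel_bound[OF z1 z0 r] by (simp add: k_def w_def w'_def s_def)
    have "cmod (E ?z) * cmod (k ?z) \<le> (\<epsilon> * (2 * s) + C * (2 * s) ^ 3) * (12 * (1 - r) / s ^ 3)"
      using Eb kb nn spos by (intro mult_mono) auto
    also have "\<dots> = 24 * \<epsilon> * (1 - r) * (1 / s\<^sup>2) + 96 * C * (1 - r)"
      using spos by (simp add: field_simps power2_eq_square power3_eq_cube)
    finally have "cmod (E ?z) * cmod (k ?z) \<le> 24 * \<epsilon> * (1 - r) * (1 / s\<^sup>2) + 96 * C * (1 - r)" .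
    then have "2 * pi * (cmod (E ?z) * cmod (k ?z)) \<le> 2 * pi * (24 * \<epsilon> * (1 - r) * (1 / s\<^sup>2) + 96 * C * (1 - r))"
      by (intro mult_left_mono) auto
    then show ?thesis
      by (simp add: norm_mult z1 s_def algebra_simps)
  qed
  have "norm (integral {0..1} (\<lambda>t. E (?g t) * k (?g t) * (2 * of_real pi * \<i> * ?g t))) \<le> integral {0..1} ?b"
    by (rule integral_norm_bound_integral) (use I B bound in \<open>auto simp: has_integral_integrable\<close>)
  then have "cmod (2 * pi * \<i> * deriv E w) \<le> 2 * pi * (24 * \<epsilon> * (1 - r) * (1 / (1 - r\<^sup>2)) + 96 * C * (1 - r))"
    unfolding integral_unique[OF I] integral_unique[OF B] .
  then have "cmod (deriv E w) \<le> 24 * \<epsilon> * ((1 - r) * (1 / (1 - r\<^sup>2))) + 96 * C * (1 - r)"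
    by (simp add: norm_mult)
  also have "24 * \<epsilon> * ((1 - r) * (1 / (1 - r\<^sup>2))) \<le> 24 * \<epsilon> * 1"
  proof (intro mult_left_mono)
    have "(1 - r) * (1 / (1 - r\<^sup>2)) = 1 / (1 + r)"
    proof -
      have "1 - r\<^sup>2 = (1 - r) * (1 + r)" by (simp add: algebra_simps power2_eq_square)
      then show ?thesis using r by simp
    qed
    then show "(1 - r) * (1 / (1 - r\<^sup>2)) \<le> 1" using r by simp
  qed (use nn in auto)
  finally show ?thesis by (simp add: w_def)
qed

text \<open>A derivative along the circle at the single point \<open>z0\<close> is enough. Removing
  the linear part shifts the derivative by exactly \<open>l\<close>; the remainder \<open>E\<close>
  is small to first order near \<open>z0\<close>, and elsewhere its boundedness is traded for the
  cubic term, whose contribution dies as \<open>r\<close> tends to 1.\<close>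

lemma radial_limit_deriv:
  fixes F :: "complex \<Rightarrow> complex"
  assumes cont: "continuous_on (cball 0 1) F" and hol: "F holomorphic_on ball 0 1"
    and z0: "cmod z0 = 1"
    and small: "\<And>\<epsilon>. \<epsilon> > 0 \<Longrightarrow> \<exists>\<delta>>0. \<forall>z. cmod z = 1 \<and> cmod (z - z0) < \<delta> \<longrightarrow>
        cmod (F z - F z0 - l * (z - z0)) \<le> \<epsilon> * cmod (z - z0)"
  shows "((\<lambda>r. deriv F (of_real r * z0)) \<longlongrightarrow> l) (at_left (1::real))"
proof (rule tendstoI)
  fix e :: real assume e: "e > 0"
  define E where "E = (\<lambda>z. F z - F z0 - l * (z - z0))"
  have contE: "continuous_on (cball 0 1) E" unfolding E_def by (intro continuous_intros cont)
  have holE: "E holomorphic_on ball 0 1" unfolding E_def by (intro holomorphic_intros hol)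
  \<comment> \<open>The term that survives \<open>r\<close> tending to 1 is
    \<open>24 * \<epsilon>\<close>, here \<open>e / 4\<close>.\<close>
  define \<epsilon> where "\<epsilon> = e / 96"
  have eps: "\<epsilon> > 0" using e by (simp add: \<epsilon>_def)
  obtain \<delta> where \<delta>: "\<delta> > 0"
    "\<And>z. cmod z = 1 \<Longrightarrow> cmod (z - z0) < \<delta> \<Longrightarrow> cmod (E z) \<le> \<epsilon> * cmod (z - z0)"
    using small[OF eps] by (auto simp: E_def)
  have "bounded (E ` cball 0 1)"
    by (intro compact_imp_bounded compact_continuous_image contE) auto
  then obtain B where B: "\<And>z. z \<in> cball 0 1 \<Longrightarrow> cmod (E z) \<le> B" "B > 0"
    unfolding bounded_pos by blast
  \<comment> \<open>Chosen so that the cubic term already exceeds the global bound \<open>B\<close>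
    at distance \<open>\<delta>\<close>.\<close>
  define C where "C = B / \<delta> ^ 3"
  have C: "C > 0" using B(2) \<delta>(1) by (simp add: C_def)
  have bd: "cmod (E z) \<le> \<epsilon> * cmod (z - z0) + C * cmod (z - z0) ^ 3" if z: "cmod z = 1" for z
  proof (cases "cmod (z - z0) < \<delta>")
    case True
    then show ?thesis using \<delta>(2)[OF z True] C by (intro add_increasing2) auto
  next
    case False
    have "cmod (E z) \<le> B" using z by (intro B) auto
    also have "B = C * \<delta> ^ 3" using \<delta>(1) by (simp add: C_def)
    also have "\<dots> \<le> C * cmod (z - z0) ^ 3"
      using False \<delta>(1) C by (intro mult_left_mono power_mono) auto
    finally show ?thesis using eps by (intro add_increasing) auto
  qed
  have est: "cmod (deriv F (of_real r * z0) - l) \<le> 24 * \<epsilon> + 96 * C * (1 - r)" if r: "1/2 \<le> r" "r < 1" for r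
  proof -
    have inb: "of_real r * z0 \<in> ball 0 1" using r z0 by (simp add: norm_mult)
    have "(F has_field_derivative deriv F (of_real r * z0)) (at (of_real r * z0))"
      using holomorphic_derivI[OF hol open_ball inb] .
    then have "(E has_field_derivative (deriv F (of_real r * z0) - l)) (at (of_real r * z0))"
      unfolding E_def by (auto intro!: derivative_eq_intros)
    then have "deriv E (of_real r * z0) = deriv F (of_real r * z0) - l" by (rule DERIV_imp_deriv)
    then show ?thesis
      using radial_derivative_estimate[OF contE holE z0 r _ _ bd] eps C by simp
  qed
  have "((\<lambda>r. 24 * \<epsilon> + 96 * C * (1 - r)) \<longlongrightarrow> 24 * \<epsilon> + 96 * C * (1 - 1)) (at_left (1::real))"
    by (intro tendsto_intros)
  then have "\<forall>\<^sub>F r in at_left 1. 24 * \<epsilon> + 96 * C * (1 - r) < e"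
    by (rule order_tendstoD(2)) (use e in \<open>simp add: \<epsilon>_def\<close>)
  moreover have "\<forall>\<^sub>F r in at_left (1::real). r \<in> {1/2<..<1}"
    by (rule eventually_at_leftI[of "1/2"]) auto
  ultimately show "\<forall>\<^sub>F r in at_left 1. dist (deriv F (of_real r * z0)) l < e"
  proof eventually_elim
    case (elim r)
    then show ?case using est[of r] by (simp add: dist_norm)
  qed
qed

text \<open>Lebesgue differentiation from both sides. \<open>integrable_ccontinuous_explicit\<close>
  treats intervals starting at \<open>x\<close>; those ending at \<open>x\<close> come from the
  reflected function, whose exceptional set is reflected back.\<close>

lemma AE_differentiable_indefinite_integral:
  fixes g :: "real \<Rightarrow> complex"
  assumes int: "\<And>a b. g integrable_on {a..b}"
  obtains N where "negligible N"
    "\<And>x \<epsilon>. x \<notin> N \<Longrightarrow> \<epsilon> > 0 \<Longrightarrow> \<exists>\<delta>>0. \<forall>h. 0 < h \<and> h < \<delta> \<longrightarrow>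
       norm (integral {x..x+h} g - of_real h * g x) \<le> \<epsilon> * h \<and>
       norm (integral {x-h..x} g - of_real h * g x) \<le> \<epsilon> * h"
proof -
  have int': "(\<lambda>x. g (- x)) integrable_on {a..b}" for a b
    using int[of "-b" "-a"] Henstock_Kurzweil_Integration.integrable_reflect_real[of g "-a" "-b"] by simp
  obtain N1 where N1: "negligible N1"
    "\<And>x e. x \<notin> N1 \<Longrightarrow> 0 < e \<Longrightarrow> \<exists>d>0. \<forall>h. 0 < h \<and> h < d \<longrightarrow>
        norm (integral (cbox x (x + h *\<^sub>R One)) g /\<^sub>R h ^ DIM(real) - g x) < e"
    using integrable_ccontinuous_explicit[of g] int by (auto simp: cbox_interval)
  obtain N2 where N2: "negligible N2"
    "\<And>x e. x \<notin> N2 \<Longrightarrow> 0 < e \<Longrightarrow> \<exists>d>0. \<forall>h. 0 < h \<and> h < d \<longrightarrow>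
        norm (integral (cbox x (x + h *\<^sub>R One)) (\<lambda>x. g (- x)) /\<^sub>R h ^ DIM(real) - g (- x)) < e"
    using integrable_ccontinuous_explicit[of "\<lambda>x. g (- x)"] int' by (auto simp: cbox_interval)
  have scal: "norm (I - of_real h * c) \<le> e * h" if "norm (I /\<^sub>R h - c) < e" "h > 0" for I c :: complex and h e :: real
  proof -
    have "I - of_real h * c = h *\<^sub>R (I /\<^sub>R h - c)"
      using that by (simp add: scaleR_conv_of_real algebra_simps)
    then have "norm (I - of_real h * c) = h * norm (I /\<^sub>R h - c)" using that by simp
    then show ?thesis using that by (simp add: mult.commute)
  qed
  show ?thesis
  proof (rule that[of "N1 \<union> uminus ` N2"])
    show "negligible (N1 \<union> uminus ` N2)"
      by (intro negligible_Un N1 negligible_differentiable_image_negligible N2)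
        (auto intro!: derivative_intros)
    fix x \<epsilon> :: real assume x: "x \<notin> N1 \<union> uminus ` N2" and e: "\<epsilon> > 0"
    have "- x \<notin> N2" using x by (metis UnI2 add.inverse_inverse imageI)
    from N2(2)[OF this e] obtain d2 where d2: "d2 > 0" "\<And>h. 0 < h \<Longrightarrow> h < d2 \<Longrightarrow>
       norm (integral {-x..-x + h} (\<lambda>x. g (- x)) /\<^sub>R h - g x) < \<epsilon>" by auto
    from x have "x \<notin> N1" by simp
    from N1(2)[OF this e] obtain d1 where d1: "d1 > 0" "\<And>h. 0 < h \<Longrightarrow> h < d1 \<Longrightarrow>
       norm (integral {x..x + h} g /\<^sub>R h - g x) < \<epsilon>" by auto
    have refl: "integral {-x..-x + h} (\<lambda>x. g (- x)) = integral {x-h..x} g" for h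
      using Henstock_Kurzweil_Integration.integral_reflect_real[of x "x-h" g] by simp
    show "\<exists>\<delta>>0. \<forall>h. 0 < h \<and> h < \<delta> \<longrightarrow>
       norm (integral {x..x+h} g - of_real h * g x) \<le> \<epsilon> * h \<and>
       norm (integral {x-h..x} g - of_real h * g x) \<le> \<epsilon> * h"
      using d1 d2 by (intro exI[of _ "min d1 d2"]) (auto intro!: scal simp: refl[symmetric])
  qed
qed

section \<open>Power series on the disc and their primitives\<close>

definition hardy :: "(nat \<Rightarrow> complex) \<Rightarrow> complex \<Rightarrow> complex" where
  "hardy a z = (\<Sum>n. a n * z ^ n)"

text \<open>The primitive vanishing at 0. Its series converges absolutely on the closed disc, where
  that of \<open>hardy\<close> need not.\<close>

definition hardy_primitive :: "(nat \<Rightarrow> complex) \<Rightarrow> complex \<Rightarrow> complex" where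
  "hardy_primitive a z = (\<Sum>n. a n / of_nat (Suc n) * z ^ Suc n)"

lemma hardy_summable:
  assumes "a \<in> H2" "cmod z < 1"
  shows "summable (\<lambda>n. norm (a n * z ^ n))"
proof (rule summable_comparison_test')
  show "summable (\<lambda>n. h2_norm a * cmod z ^ n)"
    using assms by (intro summable_mult summable_geometric) auto
  show "norm (norm (a n * z ^ n)) \<le> h2_norm a * cmod z ^ n" if "n \<ge> 0" for n
    using cmod_le_h2_norm[OF assms(1), of n] by (simp add: norm_mult norm_power mult_right_mono)
qed

text \<open>The coefficients are a product of two square-summable sequences, \<open>a\<close> and
  \<open>1 / (n + 1)\<close>.\<close>

lemma hardy_primitive_summable:
  assumes "a \<in> H2"
  shows "summable (\<lambda>n. cmod (a n / of_nat (Suc n)))"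
proof -
  have "summable (\<lambda>n. inverse (real (Suc n) ^ 2))"
    using inverse_power_summable[of 2, where 'a=real] by (subst summable_Suc_iff) simp
  then have "(\<lambda>n. inverse (of_nat (Suc n))) \<in> H2"
    unfolding H2_def mem_Collect_eq norm_inverse norm_of_nat power_inverse .
  from H2_summable_prod[OF assms this] show ?thesis
    by (simp only: norm_mult norm_inverse norm_of_nat divide_inverse)
qed

lemma continuous_on_hardy_primitive:
  assumes "a \<in> H2"
  shows "continuous_on (cball 0 1) (hardy_primitive a)"
proof (rule uniform_limit_theorem)
  show "uniform_limit (cball 0 1) (\<lambda>N z. \<Sum>n<N. a n / of_nat (Suc n) * z ^ Suc n) (hardy_primitive a) sequentially"
    unfolding hardy_primitive_def
  proof (rule Weierstrass_m_test[OF _ hardy_primitive_summable[OF assms]])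
    fix n and z :: complex assume "z \<in> cball 0 1"
    then have "cmod z ^ Suc n \<le> 1" by (intro power_le_one) auto
    then show "norm (a n / of_nat (Suc n) * z ^ Suc n) \<le> cmod (a n / of_nat (Suc n))"
      unfolding norm_mult norm_power by (intro mult_left_le) auto
  qed
  show "\<forall>\<^sub>F N in sequentially. continuous_on (cball 0 1) (\<lambda>z. \<Sum>n<N. a n / of_nat (Suc n) * z ^ Suc n)"
    by (intro always_eventually allI continuous_intros)
qed simp

lemma hardy_primitive_has_derivative:
  assumes "a \<in> H2" "cmod z < 1"
  shows "(hardy_primitive a has_field_derivative hardy a z) (at z)"
proof -
  \<comment> \<open>Reindexed so that the primitive is an ordinary power series with
    \<open>diffs c = a\<close>.\<close>
  define c where "c = (\<lambda>n. if n = 0 then 0 else a (n - 1) / of_nat n)"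
  have cS: "c (Suc n) = a n / of_nat (Suc n)" for n by (simp add: c_def)
  have sc: "summable (\<lambda>n. norm (c n))"
    by (subst summable_Suc_iff[symmetric]) (use hardy_primitive_summable[OF assms(1)] in \<open>simp only: cS\<close>)
  have s1: "summable (\<lambda>n. c n * 1 ^ n)"
    by (rule summable_norm_cancel) (use sc in simp)
  have d: "diffs c = a" by (auto simp: diffs_def cS fun_eq_iff simp del: of_nat_Suc)
  have "((\<lambda>x. \<Sum>n. c n * x ^ n) has_field_derivative (\<Sum>n. diffs c n * z ^ n)) (at z)"
    by (rule termdiffs_strong[OF s1]) (use assms(2) in simp)
  then have D: "((\<lambda>x. \<Sum>n. c n * x ^ n) has_field_derivative hardy a z) (at z)"
    by (simp add: d hardy_def)
  show ?thesis
  proof (rule has_field_derivative_transform_within_open[OF D, of "ball 0 1"])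
    fix x :: complex assume "x \<in> ball 0 1"
    then have x: "cmod x < 1" by simp
    have "summable (\<lambda>n. c n * x ^ n)"
    proof (rule summable_norm_cancel, rule summable_comparison_test'[OF sc])
      show "norm (norm (c n * x ^ n)) \<le> norm (c n)" if "n \<ge> 0" for n
        using x by (simp add: norm_mult norm_power mult_left_le power_le_one)
    qed
    from suminf_split_head[OF this] show "(\<Sum>n. c n * x ^ n) = hardy_primitive a x"
      by (simp add: hardy_primitive_def cS c_def)
  qed (use assms(2) in auto)
qed

lemma holomorphic_hardy_primitive: "a \<in> H2 \<Longrightarrow> hardy_primitive a holomorphic_on ball 0 1"
  by (auto simp: holomorphic_on_open intro!: exI hardy_primitive_has_derivative)

lemma deriv_hardy_primitive: "a \<in> H2 \<Longrightarrow> cmod z < 1 \<Longrightarrow> deriv (hardy_primitive a) z = hardy a z"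
  by (intro DERIV_imp_deriv hardy_primitive_has_derivative)

lemma holomorphic_hardy:
  assumes "a \<in> H2"
  shows "hardy a holomorphic_on ball 0 1"
proof -
  have "deriv (hardy_primitive a) holomorphic_on ball 0 1"
    by (intro holomorphic_deriv holomorphic_hardy_primitive assms open_ball)
  then show ?thesis
    by (rule holomorphic_transform) (simp add: deriv_hardy_primitive assms)
qed

section \<open>Trigonometric polynomials and the boundary density\<close>

lemma cis_has_vector_derivative:
  "((\<lambda>t. cis (k * t)) has_vector_derivative (\<i> * of_real k * cis (k * t))) (at t within S)"
proof -
  have "((\<lambda>z. exp (\<i> * of_real k * z)) has_field_derivative (\<i> * of_real k * exp (\<i> * of_real k * of_real t))) (at (of_real t))"
    by (auto intro!: derivative_eq_intros)
  from has_vector_derivative_real_field[OF this] show ?thesis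
    by (simp add: cis_conv_exp mult.assoc)
qed

lemma cis_has_integral:
  fixes k :: real
  assumes "k \<noteq> 0" "x \<le> y"
  shows "((\<lambda>t. \<i> * cis (k * t)) has_integral (cis (k * y) - cis (k * x)) / of_real k) {x..y}"
proof -
  have "((\<lambda>t. \<i> * of_real k * cis (k * t)) has_integral (cis (k * y) - cis (k * x))) {x..y}"
    by (rule fundamental_theorem_of_calculus[OF assms(2) cis_has_vector_derivative])
  from has_integral_divide[OF this, of "of_real k"] show ?thesis
    using assms(1) by simp
qed

lemma cis_int_has_integral_period:
  "((\<lambda>t. cis (of_int k * t)) has_integral (if k = 0 then 2 * of_real pi else 0)) {0..2*pi}"
proof (cases "k = 0")
  case True
  then show ?thesis
    using has_integral_const_real[of "1::complex" 0 "2*pi"] by (simp add: scaleR_conv_of_real)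
next
  case False
  have "cis (of_int k * (2 * pi)) = 1"
    using cis_multiple_2pi[of "of_int k"] by (simp add: mult.commute)
  then have "((\<lambda>t. \<i> * cis (of_int k * t)) has_integral 0) {0..2*pi}"
    using cis_has_integral[of "of_int k" 0 "2*pi"] False by simp
  from has_integral_mult_right[OF this, of "-\<i>"] show ?thesis using False by simp
qed

text \<open>In the double sum for the squared modulus only the diagonal survives integration over a
  period.\<close>

lemma Parseval_trigonometric_polynomial:
  assumes "finite A"
  shows "((\<lambda>t. (cmod (\<Sum>n\<in>A. c n * cis (real n * t)))\<^sup>2) has_integral 2 * pi * (\<Sum>n\<in>A. (cmod (c n))\<^sup>2)) {0..2*pi}"
proof -
  let ?S = "\<lambda>t. \<Sum>n\<in>A. c n * cis (real n * t)"
  have eq: "of_real ((cmod (?S t))\<^sup>2) =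
      (\<Sum>n\<in>A. \<Sum>m\<in>A. c n * cnj (c m) * cis (of_int (int n - int m) * t))" for t
  proof -
    have "of_real ((cmod (?S t))\<^sup>2) = ?S t * cnj (?S t)" by (rule complex_norm_square)
    also have "\<dots> = (\<Sum>n\<in>A. \<Sum>m\<in>A. (c n * cis (real n * t)) * (cnj (c m) * cis (- (real m * t))))"
      by (simp add: sum_product cis_cnj)
    also have "\<dots> = (\<Sum>n\<in>A. \<Sum>m\<in>A. c n * cnj (c m) * cis (of_int (int n - int m) * t))"
    proof (intro sum.cong refl)
      fix n m
      have "cis (of_int (int n - int m) * t) = cis (real n * t) * cis (- (real m * t))"
        by (simp add: cis_mult left_diff_distrib)
      then show "(c n * cis (real n * t)) * (cnj (c m) * cis (- (real m * t)))
          = c n * cnj (c m) * cis (of_int (int n - int m) * t)"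
        by (simp only: ac_simps)
    qed
    finally show ?thesis .
  qed
  have "((\<lambda>t. \<Sum>n\<in>A. \<Sum>m\<in>A. c n * cnj (c m) * cis (of_int (int n - int m) * t)) has_integral
      (\<Sum>n\<in>A. \<Sum>m\<in>A. c n * cnj (c m) * (if int n - int m = 0 then 2 * of_real pi else 0))) {0..2*pi}"
    by (intro has_integral_sum assms has_integral_mult_right cis_int_has_integral_period)
  also have "(\<Sum>n\<in>A. \<Sum>m\<in>A. c n * cnj (c m) * (if int n - int m = 0 then 2 * of_real pi else 0))
      = (\<Sum>n\<in>A. c n * cnj (c n) * (2 * of_real pi))"
  proof (rule sum.cong[OF refl])
    fix n assume "n \<in> A"
    have "(\<Sum>m\<in>A. c n * cnj (c m) * (if int n - int m = 0 then 2 * of_real pi else 0))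
        = (\<Sum>m\<in>A. if m = n then c n * cnj (c n) * (2 * of_real pi) else 0)"
      by (intro sum.cong) auto
    then show "(\<Sum>m\<in>A. c n * cnj (c m) * (if int n - int m = 0 then 2 * of_real pi else 0))
        = c n * cnj (c n) * (2 * of_real pi)"
      using \<open>n \<in> A\<close> assms by simp
  qed
  also have "\<dots> = of_real (2 * pi * (\<Sum>n\<in>A. (cmod (c n))\<^sup>2))"
    by (simp add: complex_norm_square sum_distrib_left mult.commute del: of_real_power)
  finally have "((\<lambda>t. complex_of_real ((cmod (?S t))\<^sup>2)) has_integral of_real (2 * pi * (\<Sum>n\<in>A. (cmod (c n))\<^sup>2))) {0..2*pi}"
    by (simp only: eq)
  from has_integral_Re[OF this] show ?thesis by (simp only: Re_complex_of_real)
qed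

text \<open>Carries values computed by antiderivatives over to Lebesgue integrals on the line, where
  the convergence theorems apply.\<close>

lemma set_lebesgue_integral_continuous:
  fixes f :: "real \<Rightarrow> 'a :: euclidean_space"
  assumes "continuous_on {x..y} f" "(f has_integral I) {x..y}"
  shows "(\<integral>t. indicator {x..y} t *\<^sub>R f t \<partial>lborel) = I" "integrable lborel (\<lambda>t. indicator {x..y} t *\<^sub>R f t)"
proof -
  have "set_integrable lborel {x..y} f"
    by (rule borel_integrable_atLeastAtMost'[OF assms(1)])
  then show "integrable lborel (\<lambda>t. indicator {x..y} t *\<^sub>R f t)"
    and "(\<integral>t. indicator {x..y} t *\<^sub>R f t \<partial>lborel) = I"
    using set_borel_integral_eq_integral[of "{x..y}" f] integral_unique[OF assms(2)]
    by (auto simp: set_integrable_def set_lebesgue_integral_def)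
qed

text \<open>The pointwise inequality \<open>|S| <= \<mu> |S|^2 + 1 / \<mu>\<close> replaces
  Cauchy-Schwarz for integrals; the free weight \<open>\<mu>\<close> is adapted to each block later.
  The sum differs from a Parseval sum only by the unimodular factor
  \<open>\<i> * cis t\<close>.\<close>

lemma trigonometric_polynomial_L1_bound:
  assumes "finite A" "\<mu> > 0"
  shows "(\<integral>t. norm (indicator {0..2*pi} t *\<^sub>R (\<Sum>n\<in>A. \<i> * c n * cis (real (Suc n) * t))) \<partial>lborel)
    \<le> 2 * pi * (\<mu> * (\<Sum>n\<in>A. (cmod (c n))\<^sup>2) + 1 / \<mu>)"
proof -
  let ?S = "\<lambda>t. \<Sum>n\<in>A. c n * cis (real n * t)"
  let ?T = "\<lambda>t. \<Sum>n\<in>A. \<i> * c n * cis (real (Suc n) * t)"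
  have "?T t = \<i> * cis t * ?S t" for t
    unfolding sum_distrib_left by (rule sum.cong) (auto simp: algebra_simps simp flip: cis_mult)
  then have T: "cmod (?T t) = cmod (?S t)" for t by (simp add: norm_mult)
  have cS: "continuous_on {0..2*pi} (\<lambda>t. cmod (?S t))" by (intro continuous_intros)
  have cT: "continuous_on {0..2*pi} ?T" by (intro continuous_intros)
  let ?b = "\<lambda>t. \<mu> * (cmod (?S t))\<^sup>2 + 1 / \<mu>"
  have hb: "(?b has_integral \<mu> * (2 * pi * (\<Sum>n\<in>A. (cmod (c n))\<^sup>2)) + 2 * pi * (1 / \<mu>)) {0..2*pi}"
    using has_integral_const_real[of "1 / \<mu>" 0 "2*pi"]
    by (intro has_integral_add has_integral_mult_right Parseval_trigonometric_polynomial assms) simp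
  have cb: "continuous_on {0..2*pi} ?b" by (intro continuous_intros)
  note B = set_lebesgue_integral_continuous[OF cb hb]
  have "(\<integral>t. norm (indicator {0..2*pi} t *\<^sub>R ?T t) \<partial>lborel) \<le> (\<integral>t. indicator {0..2*pi} t *\<^sub>R ?b t \<partial>lborel)"
  proof (rule integral_mono[OF _ B(2)])
    show "integrable lborel (\<lambda>t. norm (indicator {0..2*pi} t *\<^sub>R ?T t))"
      using borel_integrable_atLeastAtMost'[OF cT] unfolding set_integrable_def by (rule integrable_norm)
    fix t :: real
    have "cmod (?S t) \<le> ?b t"
    proof -
      have "0 \<le> (\<mu> * cmod (?S t) - 1)\<^sup>2" by simp
      then have "2 * \<mu> * cmod (?S t) \<le> (\<mu> * cmod (?S t))\<^sup>2 + 1"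
        by (simp add: power2_diff algebra_simps)
      moreover have "0 \<le> \<mu> * cmod (?S t)" using assms(2) by simp
      ultimately have "\<mu> * cmod (?S t) \<le> (\<mu> * cmod (?S t))\<^sup>2 + 1" by simp
      also have "\<dots> = \<mu> * ?b t"
        using assms(2) by (simp add: power2_eq_square distrib_left)
      finally have "\<mu> * cmod (?S t) \<le> \<mu> * ?b t" .
      then show ?thesis using assms(2) by simp
    qed
    then show "norm (indicator {0..2*pi} t *\<^sub>R ?T t) \<le> indicator {0..2*pi} t *\<^sub>R ?b t"
      using T by (simp add: indicator_def)
  qed
  then show ?thesis
    unfolding B(1) by (simp add: algebra_simps)
qed

lemma H2_lacunary_blocks:
  assumes "a \<in> H2"
  obtains P :: "nat \<Rightarrow> nat" where "P 0 = 0" "\<And>k. P k \<le> P (Suc k)" "\<And>k. k \<le> P k"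
    "\<And>k. (\<Sum>n\<in>{P (Suc k)..<P (Suc (Suc k))}. (cmod (a n))\<^sup>2) \<le> (1/4) ^ k"
proof -
  have s: "summable (\<lambda>n. (cmod (a n))\<^sup>2)" using assms by (simp add: H2_def)
  have "\<exists>N. \<forall>m\<ge>N. \<forall>n. norm (\<Sum>j\<in>{m..<n}. (cmod (a j))\<^sup>2) < (1/4) ^ k" for k
    using s unfolding summable_Cauchy by simp
  then obtain N0 where N0: "\<And>k m n. m \<ge> N0 k \<Longrightarrow> norm (\<Sum>j\<in>{m..<n}. (cmod (a j))\<^sup>2) < (1/4) ^ k"
    by metis
  \<comment> \<open>Summing the thresholds gives \<open>P (Suc k) >= N0 k\<close>, and the extra
    \<open>k\<close> makes \<open>P\<close> unbounded. The block that starts at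
    \<open>P 0 = 0\<close> gets no bound.\<close>
  define P where "P = (\<lambda>k. (\<Sum>j<k. N0 j) + k)"
  show ?thesis
  proof (rule that)
    show "P 0 = 0" "P k \<le> P (Suc k)" "k \<le> P k" for k by (simp_all add: P_def)
    show "(\<Sum>n\<in>{P (Suc k)..<P (Suc (Suc k))}. (cmod (a n))\<^sup>2) \<le> (1/4) ^ k" for k
      using N0[of k "P (Suc k)" "P (Suc (Suc k))"] by (simp add: P_def)
  qed
qed

text \<open>The density is an \<open>L1\<close> limit of partial sums of the Fourier series along blocks whose \<open>L2\<close> norms
  decay geometrically.\<close>
lemma boundary_density:
  assumes a: "a \<in> H2"
  obtains g :: "real \<Rightarrow> complex" where "integrable lborel g"
    "\<And>x y. 0 \<le> x \<Longrightarrow> x \<le> y \<Longrightarrow> y \<le> 2 * pi \<Longrightarrow>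
       (\<integral>t. indicator {x..y} t *\<^sub>R g t \<partial>lborel) = hardy_primitive a (cis y) - hardy_primitive a (cis x)"
proof -
  obtain P where P: "P 0 = 0" "\<And>k. P k \<le> P (Suc k)" "\<And>k. k \<le> P k"
    "\<And>k. (\<Sum>n\<in>{P (Suc k)..<P (Suc (Suc k))}. (cmod (a n))\<^sup>2) \<le> (1/4) ^ k"
    using H2_lacunary_blocks[OF a] by blast
  \<comment> \<open>The derivative in \<open>t\<close> of block \<open>k\<close> of the primitive
    along the circle; the denominators \<open>n + 1\<close> cancel.\<close>
  define d where "d = (\<lambda>k t. \<Sum>n\<in>{P k..<P (Suc k)}. \<i> * a n * cis (real (Suc n) * t))"
  define f where "f = (\<lambda>x y k t. indicator {x..y} t *\<^sub>R d k t)"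
  have cd: "continuous_on S (d k)" for S k unfolding d_def by (intro continuous_intros)
  have hd: "(d k has_integral (\<Sum>n\<in>{P k..<P (Suc k)}. a n / of_nat (Suc n) * (cis y ^ Suc n - cis x ^ Suc n))) {x..y}"
    if "x \<le> y" for k x y
    unfolding d_def
  proof (intro has_integral_sum finite_atLeastLessThan)
    fix n
    from has_integral_mult_right[OF cis_has_integral[of "real (Suc n)" x y], of "a n"] that
    show "((\<lambda>t. \<i> * a n * cis (real (Suc n) * t)) has_integral a n / of_nat (Suc n) * (cis y ^ Suc n - cis x ^ Suc n)) {x..y}"
      by (simp add: Complex.DeMoivre mult.commute mult.left_commute mult.assoc del: of_nat_Suc power_Suc)
  qed
  have intf: "integrable lborel (f x y k)" for x y k
    using borel_integrable_atLeastAtMost'[OF cd, of x y k] by (simp add: f_def set_integrable_def)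
  have sumf: "summable (\<lambda>k. \<integral>t. norm (f 0 (2*pi) k t) \<partial>lborel)"
  \<comment> \<open>Block 0 is not controlled, so comparison begins with block 1.\<close>
  proof (subst summable_Suc_iff[symmetric], rule summable_comparison_test')
    show "summable (\<lambda>k. 4 * pi * (1/2) ^ k)" by (intro summable_mult summable_geometric) simp
    fix k :: nat
    \<comment> \<open>The weight \<open>\<mu> = 2 ^ k\<close> against the energy
      \<open>(1/4) ^ k\<close> makes both summands \<open>(1/2) ^ k\<close>.\<close>
    have "(\<integral>t. norm (f 0 (2*pi) (Suc k) t) \<partial>lborel)
        \<le> 2 * pi * (2 ^ k * (\<Sum>n\<in>{P (Suc k)..<P (Suc (Suc k))}. (cmod (a n))\<^sup>2) + 1 / 2 ^ k)"
      unfolding f_def d_def by (rule trigonometric_polynomial_L1_bound) auto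
    also have "\<dots> \<le> 2 * pi * (2 ^ k * (1/4) ^ k + 1 / 2 ^ k)"
      using P(4)[of k] by (intro mult_left_mono add_mono) auto
    also have "(2::real) ^ k * (1/4) ^ k = (1/2) ^ k"
      by (simp flip: power_mult_distrib)
    also have "2 * pi * ((1/2) ^ k + 1 / 2 ^ k) = 4 * pi * (1/2) ^ k"
      by (simp add: power_one_over)
    finally show "norm (\<integral>t. norm (f 0 (2*pi) (Suc k) t) \<partial>lborel) \<le> 4 * pi * (1/2) ^ k"
      by simp
  qed
  have AEf: "AE t in lborel. summable (\<lambda>k. norm (f 0 (2*pi) k t))"
  proof -
    have [measurable]: "f 0 (2*pi) k \<in> borel_measurable lborel" for k
      using intf by (rule borel_measurable_integrable)
    have "(\<integral>\<^sup>+ t. (\<Sum>k. ennreal (norm (f 0 (2*pi) k t))) \<partial>lborel) = (\<Sum>k. \<integral>\<^sup>+ t. norm (f 0 (2*pi) k t) \<partial>lborel)"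
      by (intro nn_integral_suminf) auto
    also have "\<dots> = (\<Sum>k. ennreal (\<integral>t. norm (f 0 (2*pi) k t) \<partial>lborel))"
      by (intro arg_cong[where f=suminf] ext nn_integral_eq_integral integrable_norm intf) auto
    also have "\<dots> \<noteq> \<infinity>"
      unfolding infinity_ennreal_def by (rule ennreal_suminf_neq_top[OF sumf]) simp
    finally have "AE t in lborel. (\<Sum>k. ennreal (norm (f 0 (2*pi) k t))) \<noteq> \<infinity>"
      by (intro nn_integral_PInf_AE) auto
    then show ?thesis
    proof eventually_elim
      case (elim t)
      then show ?case by (intro summable_suminf_not_top) auto
    qed
  qed
  \<comment> \<open>The indicator inside \<open>f\<close> makes \<open>g\<close> vanish off the
    period, so one function integrable on the whole line serves every subinterval.\<close>
  define g where "g = (\<lambda>t. \<Sum>k. f 0 (2*pi) k t)"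
  show ?thesis
  proof (rule that)
    show "integrable lborel g"
      unfolding g_def by (rule integrable_suminf[OF intf AEf sumf])
    fix x y :: real assume xy: "0 \<le> x" "x \<le> y" "y \<le> 2 * pi"
    have le: "norm (f x y k t) \<le> norm (f 0 (2*pi) k t)" for k t
      using xy by (auto simp: f_def indicator_def)
    have AE': "AE t in lborel. summable (\<lambda>k. norm (f x y k t))"
      using AEf by eventually_elim (erule summable_comparison_test', use le in auto)
    have sum': "summable (\<lambda>k. \<integral>t. norm (f x y k t) \<partial>lborel)"
    proof (rule summable_comparison_test'[OF sumf])
      show "norm (\<integral>t. norm (f x y k t) \<partial>lborel) \<le> (\<integral>t. norm (f 0 (2*pi) k t) \<partial>lborel)" if "k \<ge> 0" for k
        using integral_mono[OF integrable_norm[OF intf[of x y k]] integrable_norm[OF intf[of 0 "2*pi" k]] le]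
        by simp
    qed
    have "(\<Sum>k. f x y k t) = indicator {x..y} t *\<^sub>R g t" for t
      using xy by (auto simp: f_def g_def indicator_def)
    then have "(\<lambda>k. \<integral>t. f x y k t \<partial>lborel) sums (\<integral>t. indicator {x..y} t *\<^sub>R g t \<partial>lborel)"
      using sums_integral[OF intf[of x y] AE' sum'] by simp
    then have L1: "(\<lambda>K. \<Sum>k<K. \<integral>t. f x y k t \<partial>lborel) \<longlonglongrightarrow> (\<integral>t. indicator {x..y} t *\<^sub>R g t \<partial>lborel)"
      by (simp add: sums_def)
    let ?q = "\<lambda>n. a n / of_nat (Suc n) * (cis y ^ Suc n - cis x ^ Suc n)"
    have "(\<integral>t. f x y k t \<partial>lborel) = (\<Sum>n\<in>{P k..<P (Suc k)}. ?q n)" for k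
      unfolding f_def by (rule set_lebesgue_integral_continuous(1)[OF cd hd[OF xy(2)]])
    moreover have "(\<Sum>k<K. \<Sum>n\<in>{P k..<P (Suc k)}. ?q n) = (\<Sum>n<P K. ?q n)" for K
    proof (induction K)
      case (Suc K)
      have "(\<Sum>n<P (Suc K). ?q n) = (\<Sum>n\<in>{0..<P K}. ?q n) + (\<Sum>n\<in>{P K..<P (Suc K)}. ?q n)"
        unfolding lessThan_atLeast0 using P(2)[of K] by (intro sum.atLeastLessThan_concat[symmetric]) auto
      then show ?case using Suc by (simp add: lessThan_atLeast0)
    qed (simp add: P(1))
    ultimately have L2: "(\<lambda>K. \<Sum>n<P K. ?q n) \<longlonglongrightarrow> (\<integral>t. indicator {x..y} t *\<^sub>R g t \<partial>lborel)"
      using L1 by simp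
    have sp: "(\<lambda>n. a n / of_nat (Suc n) * cis s ^ Suc n) sums hardy_primitive a (cis s)" for s
      unfolding hardy_primitive_def
      by (rule summable_sums, rule summable_norm_cancel)
        (use hardy_primitive_summable[OF a] in \<open>simp only: norm_mult norm_power norm_cis power_one mult_1_right\<close>)
    have "(\<lambda>n. \<Sum>j<n. ?q j) \<longlonglongrightarrow> hardy_primitive a (cis y) - hardy_primitive a (cis x)"
      using sums_diff[OF sp[of y] sp[of x]] by (simp add: sums_def right_diff_distrib)
    \<comment> \<open>The integrals only see the partial sums at block ends. As the primitive
      converges on the closed disc, this subsequence has the same limit.\<close>
    moreover have "filterlim P at_top sequentially"
      by (rule filterlim_at_top_mono[OF filterlim_ident]) (use P(3) in auto)
    ultimately have "(\<lambda>K. \<Sum>n<P K. ?q n) \<longlonglongrightarrow> hardy_primitive a (cis y) - hardy_primitive a (cis x)"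
      by (rule filterlim_compose)
    with L2 show "(\<integral>t. indicator {x..y} t *\<^sub>R g t \<partial>lborel) = hardy_primitive a (cis y) - hardy_primitive a (cis x)"
      by (rule LIMSEQ_unique)
  qed
qed

section \<open>Fatou's theorem\<close>

lemma cis_sub_one_small:
  assumes "\<eta> > 0"
  obtains \<delta> where "\<delta> > 0" "\<And>s. \<bar>s\<bar> < \<delta> \<Longrightarrow> cmod (cis s - 1 - \<i> * of_real s) \<le> \<eta> * \<bar>s\<bar>"
proof -
  have "((\<lambda>t. cis (1 * t)) has_vector_derivative (\<i> * of_real 1 * cis (1 * 0))) (at 0)"
    by (rule cis_has_vector_derivative)
  then have "(cis has_derivative (\<lambda>x. x *\<^sub>R \<i>)) (at 0)"
    by (simp add: has_vector_derivative_def)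
  then have "\<forall>e>0. \<exists>d>0. \<forall>y. norm (y - 0) < d \<longrightarrow> norm (cis y - cis 0 - (y - 0) *\<^sub>R \<i>) \<le> e * norm (y - 0)"
    unfolding has_derivative_at_alt by blast
  then show ?thesis
    using assms that by (auto simp: scaleR_conv_of_real mult.commute)
qed

text \<open>The angle is the imaginary part of \<open>Ln (z / cis t)\<close>, and the logarithm near
  1 is at most twice the distance to 1. It turns chord lengths, in which
  \<open>radial_limit_deriv\<close> is phrased, into parameter increments.\<close>

lemma unit_circle_angle:
  assumes "cmod z = 1" "cmod (z - cis t) < 1/2"
  obtains s where "z = cis (t + s)" "\<bar>s\<bar> \<le> 2 * cmod (z - cis t)"
proof -
  define u where "u = z / cis t"
  have nu: "cmod u = 1" using assms by (simp add: u_def norm_divide)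
  have "u - 1 = (z - cis t) / cis t" by (simp add: u_def field_simps)
  then have d: "cmod (u - 1) = cmod (z - cis t)" by (simp add: norm_divide)
  have u0: "u \<noteq> 0" using nu by auto
  have "Re (Ln u) = 0" using u0 nu by simp
  then have L: "Ln u = \<i> * of_real (Im (Ln u))" by (simp add: complex_eq_iff)
  have "u = cis (Im (Ln u))"
    using exp_Ln[OF u0] L by (metis cis_conv_exp)
  then have "z = cis (t + Im (Ln u))"
    by (simp add: u_def flip: cis_mult)
  moreover have "\<bar>Im (Ln u)\<bar> \<le> 2 * cmod (z - cis t)"
    using norm_Ln_le[of "u - 1"] d assms(2) abs_Im_le_cmod[of "Ln u"] by simp
  ultimately show ?thesis by (rule that)
qed

theorem Fatou_radial_limits:
  assumes a: "a \<in> H2"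
  shows "AE t in lborel. t \<in> {0..2*pi} \<longrightarrow>
     (\<exists>l. ((\<lambda>r. hardy a (complex_of_real r * cis t)) \<longlongrightarrow> l) (at_left 1))"
proof -
  let ?F = "hardy_primitive a"
  obtain g :: "real \<Rightarrow> complex" where g: "integrable lborel g"
    "\<And>x y. 0 \<le> x \<Longrightarrow> x \<le> y \<Longrightarrow> y \<le> 2 * pi \<Longrightarrow>
       (\<integral>t. indicator {x..y} t *\<^sub>R g t \<partial>lborel) = ?F (cis y) - ?F (cis x)"
    using boundary_density[OF a] by blast
  have si: "set_integrable lborel {x..y} g" for x y
    unfolding set_integrable_def using g(1) by (intro integrable_mult_indicator) auto
  have gi: "g integrable_on {x..y}" for x y
    by (rule set_borel_integral_eq_integral(1)[OF si])
  have gI: "integral {x..y} g = ?F (cis y) - ?F (cis x)" if "0 \<le> x" "x \<le> y" "y \<le> 2 * pi" for x y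
    using set_borel_integral_eq_integral(2)[OF si, of x y] g(2)[OF that]
    by (simp add: set_lebesgue_integral_def)
  obtain N where N: "negligible N"
    "\<And>x \<epsilon>. x \<notin> N \<Longrightarrow> \<epsilon> > 0 \<Longrightarrow> \<exists>\<delta>>0. \<forall>h. 0 < h \<and> h < \<delta> \<longrightarrow>
       norm (integral {x..x+h} g - of_real h * g x) \<le> \<epsilon> * h \<and>
       norm (integral {x-h..x} g - of_real h * g x) \<le> \<epsilon> * h"
    using AE_differentiable_indefinite_integral[of g, OF gi] by blast
  have main: "\<exists>l. ((\<lambda>r. hardy a (complex_of_real r * cis t)) \<longlongrightarrow> l) (at_left 1)"
    if t: "t \<notin> N" "0 < t" "t < 2 * pi" for t
  proof -
    \<comment> \<open>The chain rule: \<open>g t\<close> is the derivative of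
      \<open>?F (cis t)\<close> in \<open>t\<close>, that is \<open>\<i> * cis t\<close> times the
      complex derivative.\<close>
    define l where "l = g t / (\<i> * cis t)"
    have "((\<lambda>r. deriv ?F (of_real r * cis t)) \<longlongrightarrow> l) (at_left (1::real))"
    proof (rule radial_limit_deriv)
      fix \<epsilon> :: real assume e: "\<epsilon> > 0"
      obtain \<delta>1 where d1: "\<delta>1 > 0" "\<And>h. 0 < h \<Longrightarrow> h < \<delta>1 \<Longrightarrow>
           norm (integral {t..t+h} g - of_real h * g t) \<le> \<epsilon>/4 * h \<and>
           norm (integral {t-h..t} g - of_real h * g t) \<le> \<epsilon>/4 * h"
        using N(2)[OF t(1), of "\<epsilon>/4"] e by auto
      \<comment> \<open>The summand 1 covers \<open>g t = 0\<close>; the error from replacing the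
        arc by the chord becomes \<open>\<epsilon>/4 * \<bar>s\<bar>\<close>.\<close>
      define \<eta> where "\<eta> = \<epsilon> / (4 * (cmod (g t) + 1))"
      have pos: "4 * (cmod (g t) + 1) > 0" by (simp add: add_nonneg_pos)
      have eta: "\<eta> > 0" using e pos by (simp add: \<eta>_def)
      obtain \<delta>2 where d2: "\<delta>2 > 0" "\<And>s. \<bar>s\<bar> < \<delta>2 \<Longrightarrow> cmod (cis s - 1 - \<i> * of_real s) \<le> \<eta> * \<bar>s\<bar>"
        using cis_sub_one_small[OF eta] by blast
      \<comment> \<open>The halves compensate \<open>\<bar>s\<bar> < 2 * \<delta>\<close>; the last
        two entries keep \<open>t + s\<close> in the period, and \<open>1/2\<close> is the range of
        the logarithm estimate.\<close>
      define \<delta> where "\<delta> = Min {1/2, \<delta>1/2, \<delta>2/2, t/2, (2*pi - t)/2}"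
      have dpos: "\<delta> > 0" using d1(1) d2(1) t by (simp add: \<delta>_def)
      have dle: "\<delta> \<le> 1/2" "2 * \<delta> \<le> \<delta>1" "2 * \<delta> \<le> \<delta>2" "2 * \<delta> \<le> t" "2 * \<delta> \<le> 2 * pi - t"
        unfolding \<delta>_def by (simp_all add: min_def field_simps)
      have "cmod (?F z - ?F (cis t) - l * (z - cis t)) \<le> \<epsilon> * cmod (z - cis t)"
        if z: "cmod z = 1" "cmod (z - cis t) < \<delta>" for z
      proof -
        obtain s where s: "z = cis (t + s)" "\<bar>s\<bar> \<le> 2 * cmod (z - cis t)"
          using unit_circle_angle[of z t] z dle(1) by auto
        have small: "\<bar>s\<bar> < 2 * \<delta>" using s z by simp
        have "cmod (?F z - ?F (cis t) - of_real s * g t) \<le> \<epsilon>/4 * \<bar>s\<bar>"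
        proof (cases s "0::real" rule: linorder_cases)
          case less
          then have "integral {t - (-s)..t} g = ?F (cis t) - ?F z"
            using gI[of "t + s" t] small dle t by (simp add: s(1))
          then have "integral {t - (-s)..t} g - of_real (-s) * g t = - (?F z - ?F (cis t) - of_real s * g t)"
            by (simp only: of_real_minus) simp
          then have "norm (integral {t - (-s)..t} g - of_real (-s) * g t) = cmod (?F z - ?F (cis t) - of_real s * g t)"
            by (simp only: norm_minus_cancel)
          then show ?thesis using d1(2)[of "-s"] less small dle by simp
        next
          case equal
          then show ?thesis by (simp add: s(1))
        next
          case greater
          then have "integral {t..t + s} g = ?F z - ?F (cis t)"
            using gI[of t "t + s"] small dle t by (simp add: s(1))
          then show ?thesis using d1(2)[of s] greater small dle by simp
        qed
        \<comment> \<open>Passage from the angular increment to the chord: \<open>\<i> * s\<close>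
          against \<open>cis s - 1\<close>.\<close>
        moreover have "cmod (of_real s * g t - l * (z - cis t)) \<le> \<epsilon>/4 * \<bar>s\<bar>"
        proof -
          have "l * (z - cis t) = - \<i> * g t * (cis s - 1)"
            by (simp add: l_def s(1) field_simps flip: cis_mult)
          then have "of_real s * g t - l * (z - cis t) = \<i> * g t * (cis s - 1 - \<i> * of_real s)"
            by (simp add: algebra_simps)
          then have "cmod (of_real s * g t - l * (z - cis t)) = cmod (g t) * cmod (cis s - 1 - \<i> * of_real s)"
            by (simp add: norm_mult)
          also have "\<dots> \<le> (cmod (g t) + 1) * (\<eta> * \<bar>s\<bar>)"
            using d2(2)[of s] small dle by (intro mult_mono) auto
          also have "\<dots> = \<epsilon>/4 * \<bar>s\<bar>"
            using pos by (simp add: \<eta>_def field_simps)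
          finally show ?thesis .
        qed
        ultimately have "cmod ((?F z - ?F (cis t) - of_real s * g t) + (of_real s * g t - l * (z - cis t))) \<le> \<epsilon>/4 * \<bar>s\<bar> + \<epsilon>/4 * \<bar>s\<bar>"
          by (intro norm_triangle_mono)
        also have "\<dots> \<le> \<epsilon>/2 * (2 * cmod (z - cis t))"
          using mult_left_mono[OF s(2), of "\<epsilon>/2"] e by simp
        also have "(?F z - ?F (cis t) - of_real s * g t) + (of_real s * g t - l * (z - cis t))
            = ?F z - ?F (cis t) - l * (z - cis t)"
          by (simp only: diff_add_eq[symmetric] add_diff_eq diff_add_cancel)
        finally show ?thesis by simp
      qed
      then show "\<exists>\<delta>>0. \<forall>z. cmod z = 1 \<and> cmod (z - cis t) < \<delta> \<longrightarrow>
          cmod (?F z - ?F (cis t) - l * (z - cis t)) \<le> \<epsilon> * cmod (z - cis t)"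
        using dpos by blast
    qed (use a in \<open>auto intro: continuous_on_hardy_primitive holomorphic_hardy_primitive\<close>)
    moreover have "\<forall>\<^sub>F r in at_left (1::real). deriv ?F (of_real r * cis t) = hardy a (of_real r * cis t)"
    proof (rule eventually_at_leftI[of 0])
      fix r :: real assume "r \<in> {0<..<1}"
      then show "deriv ?F (of_real r * cis t) = hardy a (of_real r * cis t)"
        by (intro deriv_hardy_primitive a) (simp add: norm_mult)
    qed simp
    ultimately have "((\<lambda>r. hardy a (complex_of_real r * cis t)) \<longlongrightarrow> l) (at_left 1)"
      by (rule Lim_transform_eventually)
    then show ?thesis by blast
  qed
  have "AE t in lborel. t \<notin> N"
    using AE_not_in[OF N(1)[unfolded negligible_iff_null_sets]] by (simp only: AE_completion_iff)
  \<comment> \<open>At the endpoints one of the two one-sided intervals leaves the period, where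
    \<open>g\<close> is not tied to the primitive.\<close>
  moreover have "AE t in lborel. t \<noteq> (0::real)" "AE t in lborel. t \<noteq> 2 * pi"
    by (rule AE_lborel_singleton)+
  ultimately show ?thesis
    by eventually_elim (use main in auto)
qed

section \<open>Boundary modulus of inner sequences\<close>

lemma hardy_cprod:
  assumes "f \<in> H2" "u \<in> H2" "cmod z < 1"
  shows "hardy (cprod u f) z = hardy u z * hardy f z"
proof -
  have "hardy f z * hardy u z = (\<Sum>n. \<Sum>k\<le>n. (f k * z ^ k) * (u (n - k) * z ^ (n - k)))"
    unfolding hardy_def using assms by (intro Cauchy_product hardy_summable)
  also have "\<dots> = hardy (cprod u f) z"
    unfolding hardy_def cprod_def sum_distrib_right
  proof (intro arg_cong[where f=suminf] ext sum.cong refl)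
    fix n k :: nat assume "k \<in> {..n}"
    then have "z ^ n = z ^ k * z ^ (n - k)" by (simp flip: power_add)
    then show "(f k * z ^ k) * (u (n - k) * z ^ (n - k)) = f k * u (n - k) * z ^ n" by simp
  qed
  finally show ?thesis by (simp add: mult.commute)
qed

text \<open>A crude geometric bound. What matters is that at fixed \<open>z\<close> it is uniform
  over the unit ball of \<open>H2\<close>, so it applies to all powers of an inner function at
  once.\<close>

lemma cmod_hardy_le:
  assumes "a \<in> H2" "cmod z < 1"
  shows "cmod (hardy a z) \<le> h2_norm a * (1 / (1 - cmod z))"
proof -
  have "cmod (hardy a z) \<le> (\<Sum>n. norm (a n * z ^ n))"
    unfolding hardy_def by (rule summable_norm[OF hardy_summable[OF assms]])
  also have "\<dots> \<le> (\<Sum>n. h2_norm a * cmod z ^ n)"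
    using assms by (intro suminf_le hardy_summable summable_mult summable_geometric)
      (auto simp: norm_mult norm_power intro!: mult_right_mono cmod_le_h2_norm)
  also have "\<dots> = h2_norm a * (1 / (1 - cmod z))"
    using assms by (simp add: suminf_mult suminf_geometric summable_geometric)
  finally show ?thesis .
qed

text \<open>All powers of an inner function have norm one, so they are bounded at \<open>z\<close> uniformly in the exponent.\<close>
lemma cmod_hardy_inner_seq_le_1:
  assumes u: "inner_seq u" and z: "cmod z < 1"
  shows "cmod (hardy u z) \<le> 1"
proof (rule ccontr)
  assume "\<not> cmod (hardy u z) \<le> 1"
  then have gt: "cmod (hardy u z) > 1" by simp
  define p where "p = (\<lambda>n. (cprod u ^^ n) (\<lambda>n. if n = 0 then 1 else 0))"
  have uH: "u \<in> H2" using u by (simp add: inner_seq_def)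
  have p: "p n \<in> H2 \<and> h2_normsq (p n) = 1 \<and> hardy (p n) z = hardy u z ^ n" for n
  proof (induction n)
    case 0
    have "p 0 \<in> H2" by (rule H2_finite_support[of 1]) (simp add: p_def)
    moreover have "h2_normsq (p 0) = 1"
      using suminf_finite[of "{0}" "\<lambda>n. (cmod (p 0 n))\<^sup>2"] by (simp add: h2_normsq_def p_def)
    moreover have "hardy (p 0) z = 1"
      using suminf_finite[of "{0}" "\<lambda>n. p 0 n * z ^ n"] by (simp add: hardy_def p_def)
    ultimately show ?case by simp
  next
    case (Suc n)
    have "p (Suc n) = cprod u (p n)" by (simp add: p_def)
    then show ?case
      using Suc inner_seq_contraction(1)[OF u] h2_normsq_cprod[OF u] hardy_cprod[OF _ uH z] by simp
  qed
  obtain n where "1 / (1 - cmod z) < cmod (hardy u z) ^ n"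
    using real_arch_pow[OF gt] by blast
  moreover have "cmod (hardy u z) ^ n \<le> 1 / (1 - cmod z)"
    using cmod_hardy_le[of "p n" z] p[of n] z by (simp add: h2_norm_eq_sqrt norm_power)
  ultimately show False by simp
qed

lemma continuous_hardy_circle:
  assumes "a \<in> H2" "0 \<le> r" "r < 1"
  shows "continuous_on S (\<lambda>t. hardy a (of_real r * cis t))"
  by (rule continuous_on_compose2[OF holomorphic_on_imp_continuous_on[OF holomorphic_hardy[OF assms(1)]]])
    (use assms in \<open>auto intro!: continuous_intros simp: norm_mult\<close>)

text \<open>For fixed \<open>r < 1\<close> the partial sums are dominated by a constant, so the
  finite identity passes to the limit.\<close>

lemma Parseval_hardy:
  assumes a: "a \<in> H2" and r: "0 \<le> r" "r < 1"
  shows "(\<integral>t. indicator {0..2*pi} t *\<^sub>R (cmod (hardy a (of_real r * cis t)))\<^sup>2 \<partial>lborel)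
    = 2 * pi * (\<Sum>n. (cmod (a n))\<^sup>2 * r ^ (2 * n))"
proof -
  let ?z = "\<lambda>t. complex_of_real r * cis t"
  let ?s = "\<lambda>N t. indicator {0..2*pi} t *\<^sub>R (cmod (\<Sum>n<N. a n * ?z t ^ n))\<^sup>2"
  have nz: "cmod (?z t) = r" for t using r by (simp add: norm_mult)
  have L1: "(\<lambda>N. \<integral>t. ?s N t \<partial>lborel) \<longlonglongrightarrow> (\<integral>t. indicator {0..2*pi} t *\<^sub>R (cmod (hardy a (?z t)))\<^sup>2 \<partial>lborel)"
  proof (rule integral_dominated_convergence)
    let ?B = "(\<Sum>n. norm (a n) * r ^ n)\<^sup>2"
    show "integrable lborel (\<lambda>t. indicator {0..2*pi} t *\<^sub>R ?B)"
      using borel_integrable_atLeastAtMost'[OF continuous_on_const, of 0 "2*pi" ?B]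
      by (simp only: set_integrable_def)
    show "(\<lambda>t. indicator {0..2*pi} t *\<^sub>R (cmod (hardy a (?z t)))\<^sup>2) \<in> borel_measurable lborel"
      by (intro borel_measurable_scaleR borel_measurable_indicator borel_measurable_power borel_measurable_norm)
        (auto intro!: borel_measurable_continuous_onI continuous_on_norm continuous_hardy_circle a r)
    show "?s N \<in> borel_measurable lborel" for N
      by (intro borel_measurable_scaleR borel_measurable_indicator borel_measurable_power borel_measurable_norm)
        (auto intro!: borel_measurable_continuous_onI continuous_intros)
    show "AE t in lborel. (\<lambda>N. ?s N t) \<longlonglongrightarrow> indicator {0..2*pi} t *\<^sub>R (cmod (hardy a (?z t)))\<^sup>2"
      unfolding hardy_def
      by (intro AE_I2 tendsto_intros summable_LIMSEQ summable_norm_cancel[OF hardy_summable] a) (simp only: nz r)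
    have "cmod (\<Sum>n<N. a n * ?z t ^ n) \<le> (\<Sum>n. norm (a n) * r ^ n)" for N t
    proof -
      have s: "summable (\<lambda>n. norm (a n) * r ^ n)"
        using hardy_summable[OF a, of "of_real r"] r by (simp add: norm_mult norm_power)
      have "cmod (\<Sum>n<N. a n * ?z t ^ n) \<le> (\<Sum>n<N. norm (a n) * r ^ n)"
        by (rule sum_norm_le) (simp only: norm_mult[of "a _"] norm_power nz)
      also have "\<dots> \<le> (\<Sum>n. norm (a n) * r ^ n)"
        using r by (intro sum_le_suminf s) auto
      finally show ?thesis .
    qed
    then show "AE t in lborel. norm (?s N t) \<le> indicator {0..2*pi} t *\<^sub>R ?B" for N
      by (intro AE_I2) (auto simp: indicator_def intro!: power_mono)
  qed
  have "(\<integral>t. ?s N t \<partial>lborel) = 2 * pi * (\<Sum>n<N. (cmod (a n))\<^sup>2 * r ^ (2 * n))" for N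
  proof (rule set_lebesgue_integral_continuous(1))
    show "continuous_on {0..2*pi} (\<lambda>t. (cmod (\<Sum>n<N. a n * ?z t ^ n))\<^sup>2)"
      by (intro continuous_intros)
    have e: "a n * ?z t ^ n = a n * of_real r ^ n * cis (real n * t)" for n t
      by (simp add: power_mult_distrib Complex.DeMoivre)
    have c: "(cmod (a n * of_real r ^ n))\<^sup>2 = (cmod (a n))\<^sup>2 * r ^ (2 * n)" for n
      using r by (simp add: norm_mult norm_power power_mult_distrib mult.commute flip: power_mult)
    show "((\<lambda>t. (cmod (\<Sum>n<N. a n * ?z t ^ n))\<^sup>2) has_integral 2 * pi * (\<Sum>n<N. (cmod (a n))\<^sup>2 * r ^ (2 * n))) {0..2*pi}"
      using Parseval_trigonometric_polynomial[of "{..<N}" "\<lambda>n. a n * of_real r ^ n"]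
      unfolding e c by simp
  qed
  moreover have "summable (\<lambda>n. (cmod (a n))\<^sup>2 * r ^ (2 * n))"
  proof (rule summable_comparison_test')
    show "summable (\<lambda>n. (cmod (a n))\<^sup>2)" using a by (simp add: H2_def)
    show "norm ((cmod (a n))\<^sup>2 * r ^ (2 * n)) \<le> (cmod (a n))\<^sup>2" if "n \<ge> 0" for n
      using r by (simp add: abs_mult mult_left_le power_le_one)
  qed
  ultimately have "(\<lambda>N. \<integral>t. ?s N t \<partial>lborel) \<longlonglongrightarrow> 2 * pi * (\<Sum>n. (cmod (a n))\<^sup>2 * r ^ (2 * n))"
    by (simp only:) (intro tendsto_intros summable_LIMSEQ)
  with L1 show ?thesis by (rule LIMSEQ_unique)
qed

text \<open>The limits have modulus at most one, and by Parseval the mean of their squares is one.\<close>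
theorem inner_fun_hardy:
  assumes u: "inner_seq u"
  shows "inner_fun (hardy u)"
proof -
  have uH: "u \<in> H2" and u1: "h2_normsq u = 1" using u by (auto simp: inner_seq_def)
  \<comment> \<open>A sequence of radii makes dominated convergence and measurability of the limit
    available.\<close>
  define r where "r = (\<lambda>k. 1 - 1 / (real k + 2))"
  have r: "0 \<le> r k" "r k < 1" for k by (simp_all add: r_def field_simps)
  have "(\<lambda>k. 1 - 1 / (real k + 2)) \<longlonglongrightarrow> 1" by real_asymp
  then have rl: "r \<longlonglongrightarrow> 1" by (simp add: r_def)
  then have rl': "filterlim r (at_left 1) sequentially"
    using r by (auto simp: filterlim_at intro!: always_eventually less_imp_neq)
  let ?h = "\<lambda>k t. hardy u (complex_of_real (r k) * cis t)"
  have nz: "cmod (complex_of_real (r k) * cis t) < 1" for k t using r[of k] by (simp add: norm_mult)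
  have le1: "cmod (?h k t) \<le> 1" for k t by (rule cmod_hardy_inner_seq_le_1[OF u nz])
  \<comment> \<open>Total and measurable by construction; where a radial limit exists,
    \<open>q\<close> is the square of its modulus, and the other points form a null part of the
    period.\<close>
  define q where "q = (\<lambda>t. lim (\<lambda>k. (cmod (?h k t))\<^sup>2))"
  have [measurable]: "(\<lambda>t. ?h k t) \<in> borel_measurable borel" for k
    by (intro borel_measurable_continuous_onI continuous_hardy_circle uH r)
  have [measurable]: "q \<in> borel_measurable borel"
    unfolding q_def by (intro borel_measurable_lim_metric) measurable
  have rad: "AE t in lborel. t \<in> {0..2*pi} \<longrightarrow>
     (\<exists>l. ((\<lambda>r. hardy u (complex_of_real r * cis t)) \<longlongrightarrow> l) (at_left 1))"
    by (rule Fatou_radial_limits[OF uH])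
  have ql: "q t = (cmod l)\<^sup>2" "(\<lambda>k. (cmod (?h k t))\<^sup>2) \<longlonglongrightarrow> (cmod l)\<^sup>2"
    if "((\<lambda>r. hardy u (complex_of_real r * cis t)) \<longlongrightarrow> l) (at_left 1)" for t l
  proof -
    have "(\<lambda>k. ?h k t) \<longlonglongrightarrow> l" by (rule filterlim_compose[OF that rl'])
    then show "(\<lambda>k. (cmod (?h k t))\<^sup>2) \<longlonglongrightarrow> (cmod l)\<^sup>2" by (intro tendsto_intros)
    then show "q t = (cmod l)\<^sup>2" unfolding q_def by (rule limI)
  qed
  have qle: "AE t in lborel. 0 \<le> indicator {0..2*pi} t *\<^sub>R (1 - q t)"
    using rad
  proof eventually_elim
    case (elim t)
    show ?case
    proof (cases "t \<in> {0..2*pi}")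
      case True
      then obtain l where l: "((\<lambda>r. hardy u (complex_of_real r * cis t)) \<longlongrightarrow> l) (at_left 1)"
        using elim by blast
      have "(cmod l)\<^sup>2 \<le> 1"
        by (rule LIMSEQ_le_const2[OF ql(2)[OF l]]) (use le1 in \<open>auto intro!: power_le_one\<close>)
      then show ?thesis by (simp add: ql(1)[OF l])
    qed simp
  qed
  let ?s = "\<lambda>k t. indicator {0..2*pi} t *\<^sub>R (cmod (?h k t))\<^sup>2"
  have w: "integrable lborel (\<lambda>t. indicator {0..2*pi} t *\<^sub>R (1::real))"
    using borel_integrable_atLeastAtMost'[OF continuous_on_const, of 0 "2*pi" "1::real"]
    by (simp only: set_integrable_def)
  have conv: "AE t in lborel. (\<lambda>k. ?s k t) \<longlonglongrightarrow> indicator {0..2*pi} t *\<^sub>R q t"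
    using rad
  proof eventually_elim
    case (elim t)
    then show ?case
      using ql by (cases "t \<in> {0..2*pi}") auto
  qed
  have bnd: "AE t in lborel. norm (?s k t) \<le> indicator {0..2*pi} t *\<^sub>R (1::real)" for k
    using le1 by (intro AE_I2) (auto simp: indicator_def intro!: power_le_one)
  have ms: "?s k \<in> borel_measurable lborel" for k by measurable
  have mq: "(\<lambda>t. indicator {0..2*pi} t *\<^sub>R q t) \<in> borel_measurable lborel" by measurable
  have iq: "integrable lborel (\<lambda>t. indicator {0..2*pi} t *\<^sub>R q t)"
    by (rule integrable_dominated_convergence[OF mq ms w conv bnd])
  have L: "(\<lambda>k. \<integral>t. ?s k t \<partial>lborel) \<longlonglongrightarrow> (\<integral>t. indicator {0..2*pi} t *\<^sub>R q t \<partial>lborel)"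
    by (rule integral_dominated_convergence[OF mq ms w conv bnd])
  \<comment> \<open>With \<open>K\<close> fixed, the limit of the radii is taken in a finite sum;
    \<open>K\<close> grows only afterwards.\<close>
  have "2 * pi * (\<Sum>n<K. (cmod (u n))\<^sup>2) \<le> (\<integral>t. indicator {0..2*pi} t *\<^sub>R q t \<partial>lborel)" for K
  proof (rule LIMSEQ_le[OF _ L])
    show "(\<lambda>k. 2 * pi * (\<Sum>n<K. (cmod (u n))\<^sup>2 * r k ^ (2 * n))) \<longlonglongrightarrow> 2 * pi * (\<Sum>n<K. (cmod (u n))\<^sup>2)"
      by (rule tendsto_eq_intros refl rl | simp)+
    have "2 * pi * (\<Sum>n<K. (cmod (u n))\<^sup>2 * r k ^ (2 * n)) \<le> (\<integral>t. ?s k t \<partial>lborel)" for k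
    proof -
      have "summable (\<lambda>n. (cmod (u n))\<^sup>2 * r k ^ (2 * n))"
      proof (rule summable_comparison_test')
        show "summable (\<lambda>n. (cmod (u n))\<^sup>2)" using uH by (simp add: H2_def)
        show "norm ((cmod (u n))\<^sup>2 * r k ^ (2 * n)) \<le> (cmod (u n))\<^sup>2" if "n \<ge> 0" for n
          using r[of k] by (simp add: abs_mult mult_left_le power_le_one)
      qed
      then show ?thesis
        unfolding Parseval_hardy[OF uH r] using r[of k]
        by (intro mult_left_mono sum_le_suminf) auto
    qed
    then show "\<exists>N. \<forall>k\<ge>N. 2 * pi * (\<Sum>n<K. (cmod (u n))\<^sup>2 * r k ^ (2 * n)) \<le> (\<integral>t. ?s k t \<partial>lborel)" by blast
  qed
  moreover have "(\<lambda>K. 2 * pi * (\<Sum>n<K. (cmod (u n))\<^sup>2)) \<longlonglongrightarrow> 2 * pi * 1"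
    using sums_h2_normsq[OF uH] u1 by (intro tendsto_mult_left) (simp add: sums_def)
  ultimately have ge: "2 * pi \<le> (\<integral>t. indicator {0..2*pi} t *\<^sub>R q t \<partial>lborel)"
    by (intro LIMSEQ_le_const2) auto
  have i1: "integrable lborel (\<lambda>t. indicator {0..2*pi} t *\<^sub>R (1 - q t))"
    using Bochner_Integration.integrable_diff[OF w iq] by (simp add: algebra_simps)
  have "(\<integral>t. indicator {0..2*pi} t *\<^sub>R (1 - q t) \<partial>lborel)
      = (\<integral>t. indicator {0..2*pi} t *\<^sub>R (1::real) \<partial>lborel) - (\<integral>t. indicator {0..2*pi} t *\<^sub>R q t \<partial>lborel)"
    using Bochner_Integration.integral_diff[OF w iq] by (simp add: algebra_simps)
  also have "(\<integral>t. indicator {0..2*pi} t *\<^sub>R (1::real) \<partial>lborel) = 2 * pi" by simp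
  finally have "(\<integral>t. indicator {0..2*pi} t *\<^sub>R (1 - q t) \<partial>lborel) = 0"
    using ge integral_nonneg_AE[OF qle] by simp
  then have "AE t in lborel. indicator {0..2*pi} t *\<^sub>R (1 - q t) = 0"
    using integral_nonneg_eq_0_iff_AE[OF i1 qle] by simp
  with rad have "AE t in lborel. t \<in> {0..2*pi} \<longrightarrow>
     (\<exists>l. cmod l = 1 \<and> ((\<lambda>r. hardy u (complex_of_real r * cis t)) \<longlongrightarrow> l) (at_left 1))"
  proof eventually_elim
    case (elim t)
    show ?case
    proof
      assume t: "t \<in> {0..2*pi}"
      then obtain l where l: "((\<lambda>r. hardy u (complex_of_real r * cis t)) \<longlongrightarrow> l) (at_left 1)"
        using elim by blast
      have "(cmod l)\<^sup>2 = 1" using elim(2) t ql(1)[OF l] by simp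
      then have "cmod l = 1" using norm_ge_zero[of l] unfolding power2_eq_1_iff by linarith
      then show "\<exists>l. cmod l = 1 \<and> ((\<lambda>r. hardy u (complex_of_real r * cis t)) \<longlongrightarrow> l) (at_left 1)"
        using l by blast
    qed
  qed
  moreover have "bounded (hardy u ` ball 0 1)"
    unfolding bounded_iff by (rule exI[of _ 1]) (auto intro: cmod_hardy_inner_seq_le_1[OF u])
  ultimately show ?thesis
    using holomorphic_hardy[OF uH] by (simp add: inner_fun_def)
qed

section \<open>Outer linear polynomials\<close>

text \<open>Used to transport closedness from \<open>M\<close> to \<open>L M\<close>, seen as the
  preimage of \<open>M\<close> under the bounded inverse of \<open>L\<close>.\<close>

lemma closed_subspace_vimage:
  assumes M: "closed_subspace M"
    and T: "\<And>x. x \<in> H2 \<Longrightarrow> T x \<in> H2"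
    and add: "\<And>x y. T (\<lambda>n. x n + y n) = (\<lambda>n. T x n + T y n)"
    and scale: "\<And>c x. T (\<lambda>n. c * x n) = (\<lambda>n. c * T x n)"
    and bound: "\<And>x. x \<in> H2 \<Longrightarrow> h2_norm (T x) \<le> B * h2_norm x"
  shows "closed_subspace {x \<in> H2. T x \<in> M}"
  unfolding closed_subspace_def h2_closed_def
proof (intro conjI ballI allI impI; (elim conjE)?)
  have "T (\<lambda>n. 0) = (\<lambda>n. 0)" using scale[of 0 "\<lambda>n. 0"] by simp
  then show "(\<lambda>n. 0) \<in> {x \<in> H2. T x \<in> M}" using closed_subspace_zero[OF M] by simp
  fix x y assume x: "\<forall>k. x k \<in> {x \<in> H2. T x \<in> M}" and y: "y \<in> H2"
    and l: "(\<lambda>k. h2_norm (\<lambda>n. x k n - y n)) \<longlonglongrightarrow> 0"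
  have diff: "T (\<lambda>n. x n - y n) = (\<lambda>n. T x n - T y n)" for x y
    using add[of x "\<lambda>n. -1 * y n"] scale[of "-1" y] by simp
  have "T y \<in> M"
  proof (rule closed_subspace_lim[OF M])
    show "T (x k) \<in> M" for k using x by simp
    show "T y \<in> H2" by (rule T[OF y])
    have "(\<lambda>k. B * h2_norm (\<lambda>n. x k n - y n)) \<longlonglongrightarrow> 0"
      using tendsto_mult_left[OF l, of B] by simp
    then show "(\<lambda>k. h2_norm (\<lambda>n. T (x k) n - T y n)) \<longlonglongrightarrow> 0"
    proof (rule Lim_null_comparison[rotated], intro always_eventually allI)
      fix k
      have d: "(\<lambda>n. x k n - y n) \<in> H2" using x y by (simp add: H2_diff)
      show "norm (h2_norm (\<lambda>n. T (x k) n - T y n)) \<le> B * h2_norm (\<lambda>n. x k n - y n)"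
        using bound[OF d] h2_norm_nonneg[OF T[OF d]] by (simp add: diff)
    qed
  qed
  then show "y \<in> {x \<in> H2. T x \<in> M}" using y by simp
qed (auto simp: add scale H2_add H2_scale closed_subspace_add[OF M] closed_subspace_scale[OF M])

lemma H2_first_order: "(\<lambda>n. if n = 0 then a else if n = 1 then b else 0) \<in> H2"
  by (rule H2_finite_support[of 2]) auto

lemma H2_approx_polynomial:
  assumes "f \<in> H2" "e > 0"
  obtains N where "h2_norm (\<lambda>n. f n - trunc N f n) < e"
proof -
  have "\<forall>\<^sub>F N in sequentially. h2_norm (\<lambda>n. f n - trunc N f n) < e"
    using trunc_tendsto[OF assms(1)] assms(2) by (rule order_tendstoD(2))
  then show ?thesis using that by (auto simp: eventually_sequentially)
qed

lemma h2_norm_Mz_funpow: "x \<in> H2 \<Longrightarrow> h2_norm ((Mz ^^ k) x) = h2_norm x"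
  by (induction k) (auto simp: h2_norm_Mz H2_Mz_funpow)

lemma H2_poly_seq: "poly_seq p \<in> H2"
  by (rule H2_finite_support[of "Suc (degree p)"]) (simp add: poly_seq_def coeff_eq_0)

lemma poly_seq_monom_mult: "poly_seq (monom c k * q) = (\<lambda>n. c * (Mz ^^ k) (poly_seq q) n)"
  by (auto simp: poly_seq_def Mz_funpow coeff_monom_mult)

lemma h2_norm_sum_le:
  assumes "finite A" "\<And>k. k \<in> A \<Longrightarrow> e k \<in> H2"
  shows "h2_norm (\<lambda>n. \<Sum>k\<in>A. c k * e k n) \<le> (\<Sum>k\<in>A. cmod (c k) * h2_norm (e k))"
  using assms
proof (induction A rule: finite_induct)
  case empty
  then show ?case by (simp add: h2_norm_def)
next
  case (insert a A)
  then have "h2_norm (\<lambda>n. c a * e a n + (\<Sum>k\<in>A. c k * e k n)) \<le> h2_norm (\<lambda>n. c a * e a n) + h2_norm (\<lambda>n. \<Sum>k\<in>A. c k * e k n)"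
    by (intro h2_norm_triangle H2_scale H2_sum) auto
  with insert show ?case by (simp add: h2_norm_scale)
qed

text \<open>If \<open>q p\<close> is close to 1, then \<open>z ^ k q p\<close> is equally close to
  \<open>z ^ k\<close> because the shift is isometric, and polynomials are dense in
  \<open>H2\<close>.\<close>

lemma outer_poly_if_approx_one:
  assumes one: "\<And>e. e > 0 \<Longrightarrow> \<exists>q. h2_norm (\<lambda>n. poly_seq 1 n - poly_seq (q * p) n) < e"
  shows "outer_poly p"
  unfolding outer_poly_def
proof (intro ballI allI impI)
  fix f :: "nat \<Rightarrow> complex" and e :: real
  assume f: "f \<in> H2" and e: "e > 0"
  obtain N where N: "h2_norm (\<lambda>n. f n - trunc N f n) < e / 2"
    using H2_approx_polynomial[OF f, of "e / 2"] e by auto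
  \<comment> \<open>The sum is the factor by which the error for 1 grows when combined into
    \<open>trunc N f\<close>; adding 1 keeps the divisor positive.\<close>
  define C where "C = (\<Sum>k<N. cmod (f k)) + 1"
  have C: "C > 0" by (simp add: C_def sum_nonneg add_nonneg_pos)
  obtain q where q: "h2_norm (\<lambda>n. poly_seq 1 n - poly_seq (q * p) n) < e / (2 * C)"
    using one[of "e / (2 * C)"] e C by auto
  define Q where "Q = (\<Sum>k<N. monom (f k) k * q)"
  let ?d = "\<lambda>n. poly_seq 1 n - poly_seq (q * p) n"
  have dH: "?d \<in> H2" by (intro H2_diff H2_poly_seq)
  have "trunc N f n - poly_seq (Q * p) n = (\<Sum>k<N. f k * (Mz ^^ k) ?d n)" for n
  proof -
    have "poly_seq (Q * p) n = (\<Sum>k<N. poly_seq (monom (f k) k * (q * p)) n)"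
      by (simp add: Q_def sum_distrib_right poly_seq_def coeff_sum mult.assoc)
    also have "\<dots> = (\<Sum>k<N. f k * (Mz ^^ k) (poly_seq (q * p)) n)"
      by (simp add: poly_seq_monom_mult)
    finally have 1: "poly_seq (Q * p) n = \<dots>" .
    have "trunc N f n = (\<Sum>k<N. if k = n then f n else 0)" by (simp add: trunc_def)
    also have "\<dots> = (\<Sum>k<N. f k * (Mz ^^ k) (poly_seq 1) n)"
      by (intro sum.cong) (auto simp: Mz_funpow poly_seq_def)
    finally have 2: "trunc N f n = \<dots>" .
    show ?thesis
      unfolding 1 2 sum_subtractf[symmetric]
      by (intro sum.cong) (auto simp: Mz_funpow algebra_simps)
  qed
  then have "h2_norm (\<lambda>n. trunc N f n - poly_seq (Q * p) n) \<le> (\<Sum>k<N. cmod (f k) * h2_norm ((Mz ^^ k) ?d))"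
    using h2_norm_sum_le[of "{..<N}" "\<lambda>k. (Mz ^^ k) ?d" f] by (simp add: H2_Mz_funpow dH)
  also have "\<dots> = (\<Sum>k<N. cmod (f k)) * h2_norm ?d"
    by (simp add: h2_norm_Mz_funpow dH sum_distrib_right)
  also have "\<dots> \<le> C * h2_norm ?d"
    by (intro mult_right_mono h2_norm_nonneg dH) (simp add: C_def)
  also have "\<dots> < C * (e / (2 * C))" using q C by (intro mult_strict_left_mono)
  also have "\<dots> = e / 2" using C by simp
  finally have "h2_norm (\<lambda>n. trunc N f n - poly_seq (Q * p) n) < e / 2" .
  with N have "h2_norm (\<lambda>n. f n - poly_seq (Q * p) n) < e"
    using h2_norm_triangle_diff[OF f H2_trunc[of N f] H2_poly_seq[of "Q * p"]] by simp
  then show "\<exists>q. h2_norm (\<lambda>n. f n - poly_seq (q * p) n) < e" by blast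
qed

text \<open>The Cesaro means \<open>\<Sum>j<K. (1 - j / K) \<beta> ^ j z ^ j\<close> of the geometric series invert \<open>1 - \<beta> z\<close>
  up to the error \<open>(1 / K) (\<Sum>j=1..K. \<beta> ^ j z ^ j)\<close>, whose norm is at most \<open>1 / sqrt K\<close>.\<close>
lemma outer_poly_linear:
  assumes a: "a \<noteq> 0" and ba: "cmod b \<le> cmod a"
  shows "outer_poly [:a, b:]"
proof (rule outer_poly_if_approx_one)
  fix e :: real assume e: "e > 0"
  define \<beta> where "\<beta> = - b / a"
  have \<beta>: "cmod \<beta> \<le> 1" using assms by (simp add: \<beta>_def norm_divide)
  \<comment> \<open>The error has squared norm at most \<open>1 / K\<close>.\<close>
  obtain K :: nat where K: "1 / e\<^sup>2 < real K" using reals_Archimedean2 by blast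
  have Kpos: "K > 0" using K e by (metis less_le_trans not_gr_zero of_nat_0 zero_less_divide_1_iff zero_less_power less_asym)
  define q where "q = (\<Sum>j<K. monom ((1 - of_nat j / of_nat K) * \<beta> ^ j / a) j)"
  have cq: "coeff q n = (if n < K then (1 - of_nat n / of_nat K) * \<beta> ^ n / a else 0)" for n
    by (simp add: q_def coeff_sum)
  \<comment> \<open>The weight vanishes at \<open>n = K\<close>, so one formula also covers the
    first coefficient beyond the sum. Consecutive weights differ by \<open>1 / K\<close>, which is
    what remains after multiplication by the linear factor.\<close>
  have cq': "coeff q n = (1 - of_nat n / of_nat K) * \<beta> ^ n / a" if "n \<le> K" for n
    using that Kpos by (cases "n = K") (auto simp: cq)
  let ?d = "\<lambda>n. poly_seq 1 n - poly_seq (q * [:a, b:]) n"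
  have d: "?d n = (if 1 \<le> n \<and> n \<le> K then \<beta> ^ n / of_nat K else 0)" for n
  proof (cases n)
    case 0
    then show ?thesis using Kpos a by (simp add: poly_seq_def cq)
  next
    case (Suc m)
    have b: "b = - \<beta> * a" using a by (simp add: \<beta>_def)
    have "?d n = - (a * coeff q (Suc m) + b * coeff q m)"
      by (simp add: poly_seq_def Suc mult.commute)
    also have "\<dots> = (if 1 \<le> n \<and> n \<le> K then \<beta> ^ n / of_nat K else 0)"
    proof (cases "n \<le> K")
      case True
      have "a * coeff q (Suc m) + b * coeff q m =
          (1 - of_nat (Suc m) / of_nat K) * \<beta> ^ Suc m - (1 - of_nat m / of_nat K) * \<beta> ^ Suc m"
        using True Suc a by (simp add: cq' b)
      also have "\<dots> = - (\<beta> ^ Suc m / of_nat K)"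
        using Kpos by (simp add: field_simps)
      finally show ?thesis using True Suc by simp
    next
      case False
      then show ?thesis using Suc by (simp add: cq)
    qed
    finally show ?thesis .
  qed
  have dH: "?d \<in> H2" by (intro H2_diff H2_poly_seq)
  have "h2_normsq ?d \<le> 1 / real K"
  proof (rule H2_normsq_leI(2))
    fix J
    have "(\<Sum>n<J. (cmod (?d n))\<^sup>2) \<le> (\<Sum>n<J. if n \<in> {1..K} then 1 / (real K)\<^sup>2 else 0)"
    proof (rule sum_mono)
      fix n
      have "(cmod (\<beta> ^ n / of_nat K))\<^sup>2 \<le> 1 / (real K)\<^sup>2"
        using \<beta> by (simp add: norm_divide norm_power power_divide divide_right_mono power_le_one)
      then show "(cmod (?d n))\<^sup>2 \<le> (if n \<in> {1..K} then 1 / (real K)\<^sup>2 else 0)"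
        unfolding d by simp
    qed
    also have "\<dots> = (\<Sum>n\<in>{..<J} \<inter> {1..K}. 1 / (real K)\<^sup>2)"
      by (rule sum.inter_restrict[symmetric]) simp
    also have "\<dots> \<le> (\<Sum>n\<in>{1..K}. 1 / (real K)\<^sup>2)" by (rule sum_mono2) auto
    also have "\<dots> = 1 / real K" using Kpos by (simp add: power2_eq_square)
    finally show "(\<Sum>n<J. (cmod (?d n))\<^sup>2) \<le> 1 / real K" .
  qed
  also have "\<dots> < e\<^sup>2" using K Kpos e by (simp add: field_simps)
  finally have "h2_norm ?d < e"
    using e by (simp add: h2_norm_eq_sqrt real_less_lsqrt h2_normsq_nonneg[OF dH])
  then show "\<exists>q. h2_norm (\<lambda>n. poly_seq 1 n - poly_seq (q * [:a, b:]) n) < e" by blast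
qed

section \<open>Invariant subspaces of the perturbed shift\<close>

definition Lmap :: "complex \<Rightarrow> complex \<Rightarrow> (nat \<Rightarrow> complex) \<Rightarrow> nat \<Rightarrow> complex" where
  "Lmap a b x = (\<lambda>n. x n + x 0 * (if n = 0 then a - 1 else if n = 1 then b else 0))"

text \<open>The zeroth coefficient of \<open>Lmap a b x\<close> is \<open>a * x 0\<close>, so
  division by \<open>a\<close> recovers \<open>x 0\<close> and with it the correction to
  remove.\<close>

definition Linv :: "complex \<Rightarrow> complex \<Rightarrow> (nat \<Rightarrow> complex) \<Rightarrow> nat \<Rightarrow> complex" where
  "Linv a b x = (\<lambda>n. x n - x 0 / a * (if n = 0 then a - 1 else if n = 1 then b else 0))"

lemma S1_eq_Mz_Lmap: "S1 a b x = Mz (Lmap a b x)"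
  by (auto simp: S1_def Mz_def Fop_def Lmap_def fun_eq_iff)

lemma Linv_Lmap: "a \<noteq> 0 \<Longrightarrow> Linv a b (Lmap a b x) = x"
  by (auto simp: Linv_def Lmap_def fun_eq_iff field_simps)

lemma Lmap_Linv: "a \<noteq> 0 \<Longrightarrow> Lmap a b (Linv a b x) = x"
  by (auto simp: Linv_def Lmap_def fun_eq_iff field_simps)

text \<open>The correction sees only the zeroth coefficient, which is 0 after a shift. Hence
  \<open>S1\<close> acts on \<open>z H2\<close> as the plain shift.\<close>

lemma Lmap_Mz: "Lmap a b (Mz x) = Mz x" and Linv_Mz: "Linv a b (Mz x) = Mz x"
  by (auto simp: Linv_def Lmap_def Mz_def)

lemma Lmap_diff_scale: "Lmap a b (\<lambda>n. x n - c * y n) = (\<lambda>n. Lmap a b x n - c * Lmap a b y n)"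
  by (auto simp: Lmap_def algebra_simps)

lemma H2_Lmap: "x \<in> H2 \<Longrightarrow> Lmap a b x \<in> H2"
  unfolding Lmap_def by (intro H2_add H2_scale H2_first_order)

lemma H2_Linv: "x \<in> H2 \<Longrightarrow> Linv a b x \<in> H2"
  unfolding Linv_def by (intro H2_diff H2_scale H2_first_order)

lemma h2_norm_Linv_bounded:
  obtains B where "\<And>x. x \<in> H2 \<Longrightarrow> h2_norm (Linv a b x) \<le> B * h2_norm x"
proof
  let ?w = "\<lambda>n::nat. if n = 0 then a - 1 else if n = 1 then b else (0::complex)"
  fix x assume x: "x \<in> H2"
  have w: "?w \<in> H2" by (rule H2_first_order)
  have "h2_norm (Linv a b x) = h2_norm (\<lambda>n. x n + (- (x 0 / a)) * ?w n)"
    by (simp add: Linv_def)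
  also have "\<dots> \<le> h2_norm x + h2_norm (\<lambda>n. (- (x 0 / a)) * ?w n)"
    by (intro h2_norm_triangle x H2_scale w)
  also have "h2_norm (\<lambda>n. (- (x 0 / a)) * ?w n) = cmod (x 0) / cmod a * h2_norm ?w"
    by (simp only: h2_norm_scale[OF w] norm_minus_cancel norm_divide)
  also have "\<dots> \<le> h2_norm x / cmod a * h2_norm ?w"
    by (intro mult_right_mono divide_right_mono cmod_le_h2_norm x h2_norm_nonneg w) auto
  finally show "h2_norm (Linv a b x) \<le> (1 + h2_norm ?w / cmod a) * h2_norm x"
    by (simp add: algebra_simps)
qed

text \<open>The last conclusion splits \<open>M\<close> into multiples of \<open>\<phi>\<close> and
  elements of \<open>S1 M\<close>. It reduces generation of \<open>M\<close> by
  \<open>\<phi>\<close> to reaching the vectors \<open>z u h\<close>.\<close>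

lemma S1_invariant_subspace_structure:
  assumes a: "a \<noteq> 0" and ba: "cmod b \<le> cmod a"
    and M: "closed_subspace M" and inv: "S1 a b ` M \<subseteq> M" and ne: "M \<noteq> {\<lambda>n. 0}"
  obtains u p \<phi> where "inner_seq u" "outer_poly p" "\<phi> \<in> M" "Lmap a b \<phi> = cprod u (poly_seq p)"
    "ominus M (S1 a b ` M) = {(\<lambda>n. c * \<phi> n) | c. True}"
    "\<forall>x\<in>M. \<exists>c. \<exists>h\<in>H2. x = (\<lambda>n. c * \<phi> n + Mz (cprod u h) n)"
proof -
  have MH: "x \<in> H2" if "x \<in> M" for x using closed_subspace_subset[OF M that] .
  define N where "N = {x \<in> H2. Linv a b x \<in> M}"
  have N_eq: "N = Lmap a b ` M"
  proof
    show "N \<subseteq> Lmap a b ` M"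
    proof
      fix x assume "x \<in> N"
      then show "x \<in> Lmap a b ` M"
        using Lmap_Linv[OF a, of b x] by (intro image_eqI[of _ _ "Linv a b x"]) (auto simp: N_def)
    qed
    show "Lmap a b ` M \<subseteq> N"
      using Linv_Lmap[OF a] by (auto simp: N_def H2_Lmap MH)
  qed
  obtain B where B: "\<And>x. x \<in> H2 \<Longrightarrow> h2_norm (Linv a b x) \<le> B * h2_norm x"
    using h2_norm_Linv_bounded by blast
  have N: "closed_subspace N"
    unfolding N_def
    by (rule closed_subspace_vimage[OF M H2_Linv _ _ B])
      (auto simp: Linv_def algebra_simps add_divide_distrib)
  have Ninv: "shift_invariant N"
    unfolding shift_invariant_def
  proof
    fix y assume "y \<in> N"
    then obtain x where x: "x \<in> M" "y = Lmap a b x" by (auto simp: N_eq)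
    \<comment> \<open>\<open>z y\<close> is the image of \<open>x\<close> under \<open>S1\<close>,
      and \<open>Linv\<close> leaves it unchanged.\<close>
    then have "Mz y \<in> M" using inv by (auto simp: S1_eq_Mz_Lmap)
    then show "Mz y \<in> N" by (simp add: N_def Linv_Mz MH)
  qed
  obtain x0 where x0: "x0 \<in> M" "x0 \<noteq> (\<lambda>n. 0)" using ne closed_subspace_zero[OF M] by blast
  have "Lmap a b x0 \<noteq> (\<lambda>n. 0)"
  proof
    assume "Lmap a b x0 = (\<lambda>n. 0)"
    then have "x0 = Linv a b (\<lambda>n. 0)" using Linv_Lmap[OF a, of b x0] by simp
    then show False using x0 by (simp add: Linv_def)
  qed
  then have Nne: "N \<noteq> {\<lambda>n. 0}" using x0(1) by (auto simp: N_eq)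
  obtain u where u: "inner_seq u" "N = cprod u ` H2"
    by (rule Beurling[OF N Ninv Nne])
  have uH: "u \<in> H2" using u(1) by (simp add: inner_seq_def)
  have S1M: "S1 a b ` M = (\<lambda>h. Mz (cprod u h)) ` H2"
  proof -
    have "S1 a b ` M = Mz ` N" unfolding N_eq by (auto simp: S1_eq_Mz_Lmap)
    then show ?thesis by (auto simp: u(2))
  qed
  define p where "p = [:a, b * of_real ((cmod (u 0))\<^sup>2):]"
  have "(cmod (u 0))\<^sup>2 \<le> 1"
    using sum_le_h2_normsq[OF uH, of "{0}"] u(1) by (simp add: inner_seq_def)
  then have "cmod b * (cmod (u 0))\<^sup>2 \<le> cmod a"
    using ba by (meson mult_left_le norm_ge_zero order_trans)
  then have outer: "outer_poly p"
    unfolding p_def using a by (intro outer_poly_linear) (auto simp: norm_mult norm_power)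
  define \<phi> where "\<phi> = Linv a b (cprod u (poly_seq p))"
  have upH: "cprod u (poly_seq p) \<in> H2" by (rule inner_seq_contraction(1)[OF u(1) H2_poly_seq])
  have upN: "cprod u (poly_seq p) \<in> N" using u(2) H2_poly_seq by blast
  have phiM: "\<phi> \<in> M" using upN by (simp add: N_def \<phi>_def)
  have L: "Lmap a b \<phi> = cprod u (poly_seq p)" by (simp add: \<phi>_def Lmap_Linv[OF a])
  have phi_eq: "\<phi> = (\<lambda>n. cprod u (poly_seq p) n - u 0 * (if n = 0 then a - 1 else if n = 1 then b else 0))"
    using a by (simp add: \<phi>_def Linv_def cprod_def poly_seq_def p_def)
  let ?w = "\<lambda>n::nat. if n = 0 then a - 1 else if n = 1 then b else (0::complex)"
  \<comment> \<open>For \<open>k > 0\<close> both contributions vanish because \<open>p\<close> and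
    \<open>?w\<close> have degree at most one; for \<open>k = 0\<close> they cancel by the choice of
    the linear coefficient of \<open>p\<close>.\<close>
  have orth_k: "h2_inner \<phi> ((Mz ^^ Suc k) u) = 0" for k
  proof -
    have uk: "(Mz ^^ Suc k) u \<in> H2" by (rule H2_Mz_funpow[OF uH])
    have "h2_inner ?w ((Mz ^^ Suc k) u) = (\<Sum>n\<in>{0, 1}. ?w n * cnj ((Mz ^^ Suc k) u n))"
      unfolding h2_inner_def by (rule suminf_finite) auto
    also have "\<dots> = (if k = 0 then b * cnj (u 0) else 0)"
      by (auto simp: Mz_funpow simp del: funpow.simps)
    finally have w: "h2_inner ?w ((Mz ^^ Suc k) u) = (if k = 0 then b * cnj (u 0) else 0)" .
    have "h2_inner \<phi> ((Mz ^^ Suc k) u) = h2_inner (cprod u (poly_seq p)) ((Mz ^^ Suc k) u)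
        - u 0 * h2_inner ?w ((Mz ^^ Suc k) u)"
      unfolding phi_eq
      by (simp only: h2_inner_diff_left[OF upH H2_scale[OF H2_first_order] uk] h2_inner_scale_left[OF H2_first_order uk])
    also have "h2_inner (cprod u (poly_seq p)) ((Mz ^^ Suc k) u) = coeff p (Suc k)"
      using h2_inner_cprod_shift[OF u(1) H2_poly_seq, of p "Suc k"] by (simp add: poly_seq_def)
    also have "coeff p (Suc k) = (if k = 0 then u 0 * (b * cnj (u 0)) else 0)"
      by (simp add: p_def complex_norm_square coeff_pCons mult.left_commute split: nat.splits del: of_real_power)
    finally show ?thesis unfolding w by simp
  qed
  have phiH: "\<phi> \<in> H2" by (rule MH[OF phiM])
  have orth: "h2_inner \<phi> (Mz (cprod u h)) = 0" if h: "h \<in> H2" for h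
  proof -
    have "h2_inner (cprod u (Mz h)) \<phi> = 0"
    proof (rule LIMSEQ_unique[OF h2_inner_cprod_tendsto[OF u(1) H2_Mz[OF h] phiH]])
      have "Mz h k * h2_inner ((Mz ^^ k) u) \<phi> = 0" for k
      proof (cases k)
        case 0
        then show ?thesis by (simp add: Mz_def)
      next
        case (Suc j)
        then show ?thesis
          using orth_k[of j] h2_inner_cnj[OF phiH H2_Mz_funpow[OF uH], of "Suc j"] by simp
      qed
      then show "(\<lambda>N. \<Sum>k<N. Mz h k * h2_inner ((Mz ^^ k) u) \<phi>) \<longlonglongrightarrow> 0"
        by (simp only: sum.neutral_const tendsto_const)
    qed
    then show ?thesis
      using h2_inner_cnj[OF inner_seq_contraction(1)[OF u(1) H2_Mz[OF h]] phiH] by (simp add: cprod_Mz)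
  qed
  have decomp: "\<exists>c. \<exists>h\<in>H2. x = (\<lambda>n. c * \<phi> n + Mz (cprod u h) n)" if x: "x \<in> M" for x
  proof -
    obtain g where g: "g \<in> H2" "Lmap a b x = cprod u g" using x N_eq u(2) by blast
    \<comment> \<open>Matches the constant coefficients, as that of \<open>p\<close> is
      \<open>a\<close>; then \<open>g - c p\<close> is divisible by \<open>z\<close>, and
      \<open>L\<close> acts trivially on the remainder.\<close>
    define c where "c = g 0 / a"
    define h where "h = (\<lambda>n. g (Suc n) - c * poly_seq p (Suc n))"
    have gp: "(\<lambda>n. g n - c * poly_seq p n) \<in> H2" by (intro H2_diff H2_scale H2_poly_seq g)
    have Mzh: "(\<lambda>n. g n - c * poly_seq p n) = Mz h"
    proof
      fix n
      show "g n - c * poly_seq p n = Mz h n"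
        using a by (cases n) (auto simp: h_def Mz_def c_def poly_seq_def p_def)
    qed
    have hH: "h \<in> H2"
      using gp summable_Suc_iff[of "\<lambda>n. (cmod (g n - c * poly_seq p n))\<^sup>2"] by (simp add: H2_def h_def)
    have "cprod u (Mz h) = (\<lambda>n. cprod u g n - c * cprod u (poly_seq p) n)"
      unfolding Mzh[symmetric] cprod_diff cprod_scale ..
    then have "Lmap a b (\<lambda>n. x n - c * \<phi> n) = Mz (cprod u h)"
      by (simp add: Lmap_diff_scale L g(2) cprod_Mz)
    then have "(\<lambda>n. x n - c * \<phi> n) = Mz (cprod u h)"
      using Linv_Lmap[OF a, of b "\<lambda>n. x n - c * \<phi> n"] by (simp add: Linv_Mz)
    then have "x = (\<lambda>n. c * \<phi> n + Mz (cprod u h) n)"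
      by (auto simp: fun_eq_iff) (metis add.commute diff_add_cancel)
    then show ?thesis using hH by blast
  qed
  have "ominus M (S1 a b ` M) = {(\<lambda>n. c * \<phi> n) | c. True}"
  proof
    show "ominus M (S1 a b ` M) \<subseteq> {(\<lambda>n. c * \<phi> n) | c. True}"
    proof
      fix x assume "x \<in> ominus M (S1 a b ` M)"
      then have x: "x \<in> M" "\<And>h. h \<in> H2 \<Longrightarrow> h2_inner x (Mz (cprod u h)) = 0"
        by (auto simp: ominus_def S1M)
      obtain c h where h: "h \<in> H2" and xe: "x = (\<lambda>n. c * \<phi> n + Mz (cprod u h) n)"
        using decomp[OF x(1)] by blast
      have hH: "Mz (cprod u h) \<in> H2" by (intro H2_Mz inner_seq_contraction(1)[OF u(1) h])
      \<comment> \<open>Testing \<open>x\<close> against its own component in \<open>S1 M\<close>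
        shows that this component is zero.\<close>
      have "h2_inner x (Mz (cprod u h)) = c * h2_inner \<phi> (Mz (cprod u h)) + h2_inner (Mz (cprod u h)) (Mz (cprod u h))"
        unfolding xe by (simp only: h2_inner_add_left[OF H2_scale[OF phiH] hH hH] h2_inner_scale_left[OF phiH hH])
      then have "h2_normsq (Mz (cprod u h)) = 0"
        using x(2)[OF h] orth[OF h] by (simp add: h2_inner_self[OF hH])
      then have "Mz (cprod u h) = (\<lambda>n. 0)" by (rule h2_normsq_eq_0[OF hH])
      then show "x \<in> {(\<lambda>n. c * \<phi> n) | c. True}" using xe by auto
    qed
    show "{(\<lambda>n. c * \<phi> n) | c. True} \<subseteq> ominus M (S1 a b ` M)"
      using orth by (auto simp: ominus_def S1M closed_subspace_scale[OF M phiM] h2_inner_scale_left[OF phiH]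
          H2_Mz inner_seq_contraction(1)[OF u(1)])
  qed
  then show ?thesis
    using that[OF u(1) outer phiM L] decomp by blast
qed

text \<open>One application of \<open>S1\<close> sends \<open>\<phi>\<close> to
  \<open>z u p\<close>; from there on \<open>S1\<close> is the shift, so all \<open>z u q p\<close>
  with polynomial \<open>q\<close> lie in \<open>K\<close>. Outerness lets \<open>q p\<close>
  approach \<open>h\<close>, and multiplication by \<open>z u\<close> does not increase the
  error.\<close>

lemma shifted_multiples_in_S1_invariant:
  assumes u: "inner_seq u" and p: "outer_poly p" and K: "closed_subspace K" "S1 a b ` K \<subseteq> K"
    and phi: "\<phi> \<in> K" "Lmap a b \<phi> = cprod u (poly_seq p)" and h: "h \<in> H2"
  shows "Mz (cprod u h) \<in> K"
proof -
  have shift: "(Mz ^^ k) (Mz (cprod u (poly_seq p))) \<in> K" for k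
  proof (induction k)
    case 0
    have "S1 a b \<phi> \<in> K" using K phi(1) by blast
    then show ?case by (simp add: S1_eq_Mz_Lmap phi(2))
  next
    case (Suc k)
    let ?y = "(Mz ^^ k) (Mz (cprod u (poly_seq p)))"
    have "S1 a b ?y \<in> K" using K Suc by blast
    moreover have "?y = Mz ((Mz ^^ k) (cprod u (poly_seq p)))" by (metis funpow_swap1)
    ultimately show ?case by (simp add: S1_eq_Mz_Lmap Lmap_Mz)
  qed
  have upH: "cprod u (poly_seq p) \<in> H2" by (rule inner_seq_contraction(1)[OF u H2_poly_seq])
  have cprod_funpow: "cprod u ((Mz ^^ k) f) = (Mz ^^ k) (cprod u f)" for k f
    by (induction k) (auto simp: cprod_Mz)
  have poly: "Mz (cprod u (poly_seq (q * p))) \<in> K" for q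
  proof -
    have "q * p = (\<Sum>k\<le>degree q. monom (coeff q k) k * p)"
      by (simp add: sum_distrib_right[symmetric] poly_as_sum_of_monoms)
    then have "poly_seq (q * p) = (\<lambda>n. \<Sum>k\<le>degree q. poly_seq (monom (coeff q k) k * p) n)"
      by (simp add: poly_seq_def coeff_sum)
    then have e: "poly_seq (q * p) = (\<lambda>n. \<Sum>k\<le>degree q. coeff q k * (Mz ^^ k) (poly_seq p) n)"
      by (simp add: poly_seq_monom_mult)
    have "cprod u (poly_seq (q * p)) = (\<lambda>n. \<Sum>k\<le>degree q. coeff q k * cprod u ((Mz ^^ k) (poly_seq p)) n)"
      unfolding e cprod_def
      by (auto simp: sum_distrib_right sum_distrib_left mult.assoc intro: sum.swap)
    then have "Mz (cprod u (poly_seq (q * p))) =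
        (\<lambda>n. \<Sum>k\<le>degree q. coeff q k * (Mz ^^ k) (Mz (cprod u (poly_seq p))) n)"
      unfolding cprod_funpow by (auto simp: Mz_def Mz_funpow fun_eq_iff intro!: sum.neutral sum.cong)
    then show ?thesis using closed_subspace_sum[OF K(1) shift] by simp
  qed
  have "\<exists>q. h2_norm (\<lambda>n. h n - poly_seq (q * p) n) < 1 / (real k + 1)" for k
    using p h by (auto simp: outer_poly_def)
  then obtain q where q: "\<And>k. h2_norm (\<lambda>n. h n - poly_seq (q k * p) n) < 1 / (real k + 1)" by metis
  show ?thesis
  proof (rule closed_subspace_lim[OF K(1) poly])
    show "Mz (cprod u h) \<in> H2" by (intro H2_Mz inner_seq_contraction(1)[OF u h])
    show "(\<lambda>k. h2_norm (\<lambda>n. Mz (cprod u (poly_seq (q k * p))) n - Mz (cprod u h) n)) \<longlonglongrightarrow> 0"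
    proof (rule Lim_null_comparison)
      show "(\<lambda>k. 1 / (real k + 1)) \<longlonglongrightarrow> 0" by real_asymp
      have "norm (h2_norm (\<lambda>n. Mz (cprod u (poly_seq (q k * p))) n - Mz (cprod u h) n)) \<le> 1 / (real k + 1)" for k
      proof -
        let ?f = "poly_seq (q k * p)"
        have d: "(\<lambda>n. cprod u ?f n - cprod u h n) \<in> H2"
          by (intro H2_diff inner_seq_contraction(1)[OF u] H2_poly_seq h)
        have "h2_norm (\<lambda>n. Mz (cprod u ?f) n - Mz (cprod u h) n) = h2_norm (\<lambda>n. cprod u ?f n - cprod u h n)"
          using h2_norm_Mz[OF d] by (simp add: Mz_diff)
        also have "\<dots> \<le> h2_norm (\<lambda>n. ?f n - h n)"
          by (rule inner_seq_h2_norm_diff_le[OF u H2_poly_seq h])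
        also have "\<dots> \<le> 1 / (real k + 1)"
          using q[of k] h2_norm_minus_commute[of h ?f] by simp
        finally have "h2_norm (\<lambda>n. Mz (cprod u ?f) n - Mz (cprod u h) n) \<le> 1 / (real k + 1)" .
        moreover have "0 \<le> h2_norm (\<lambda>n. Mz (cprod u ?f) n - Mz (cprod u h) n)"
          using h2_norm_nonneg[OF H2_Mz[OF d]] by (simp add: Mz_diff)
        ultimately show ?thesis by simp
      qed
      then show "\<forall>\<^sub>F k in sequentially. norm (h2_norm (\<lambda>n. Mz (cprod u (poly_seq (q k * p))) n - Mz (cprod u h) n)) \<le> 1 / (real k + 1)"
        by simp
    qed
  qed
qed

section \<open>From coefficients back to functions on the disc\<close>

lemma hardy_Mz:
  assumes "f \<in> H2" "cmod z < 1"
  shows "hardy (Mz f) z = z * hardy f z"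
proof -
  have s: "summable (\<lambda>n. f n * z ^ n)" by (rule summable_norm_cancel[OF hardy_summable[OF assms]])
  have "hardy (Mz f) z = (\<Sum>n. Mz f (Suc n) * z ^ Suc n) + Mz f 0 * z ^ 0"
    unfolding hardy_def
    using suminf_split_head[OF summable_norm_cancel[OF hardy_summable[OF H2_Mz[OF assms(1)] assms(2)]]] by simp
  also have "\<dots> = (\<Sum>n. z * (f n * z ^ n))" by (simp add: Mz_def mult.left_commute)
  also have "\<dots> = z * hardy f z" unfolding hardy_def by (rule suminf_mult[OF s])
  finally show ?thesis .
qed

lemma hardy_poly_seq: "hardy (poly_seq p) z = poly p z"
proof -
  have "hardy (poly_seq p) z = (\<Sum>n\<le>degree p. coeff p n * z ^ n)"
    unfolding hardy_def poly_seq_def by (rule suminf_finite) (auto simp: coeff_eq_0)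
  then show ?thesis by (simp add: poly_altdef)
qed

theorem theorem6p2:
  fixes a0 b0 :: complex and M :: "(nat \<Rightarrow> complex) set"
  assumes "0 < cmod b0" and "cmod b0 \<le> cmod a0"
    and "closed_subspace M" and "S1 a0 b0 ` M \<subseteq> M" and "M \<noteq> {\<lambda>n. 0}"
  shows "M = gen_inv (S1 a0 b0) (ominus M (S1 a0 b0 ` M)) \<longleftrightarrow>
    (\<exists>\<theta> p \<phi>. inner_fun \<theta> \<and> outer_poly p \<and> \<phi> \<in> H2 \<and>
        ominus M (S1 a0 b0 ` M) = {(\<lambda>n. c * \<phi> n) | c. True} \<and>
        (\<forall>z\<in>ball 0 1. (\<Sum>n. S1 a0 b0 \<phi> n * z ^ n) = z * poly p z * \<theta> z))"
proof -
  have a0: "a0 \<noteq> 0" using assms(1,2) by auto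
  obtain u p \<phi> where u: "inner_seq u" and p: "outer_poly p" and phi: "\<phi> \<in> M"
    and L: "Lmap a0 b0 \<phi> = cprod u (poly_seq p)"
    and om: "ominus M (S1 a0 b0 ` M) = {(\<lambda>n. c * \<phi> n) | c. True}"
    and dec: "\<forall>x\<in>M. \<exists>c. \<exists>h\<in>H2. x = (\<lambda>n. c * \<phi> n + Mz (cprod u h) n)"
    by (rule S1_invariant_subspace_structure[OF a0 assms(2-5)])
  \<comment> \<open>\<open>M\<close> itself competes in the intersection, which gives one inclusion;
    for the other, every competitor contains \<open>\<phi>\<close> and hence both parts of the
    decomposition.\<close>
  have "M = gen_inv (S1 a0 b0) (ominus M (S1 a0 b0 ` M))"
  proof
    show "gen_inv (S1 a0 b0) (ominus M (S1 a0 b0 ` M)) \<subseteq> M"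
      unfolding gen_inv_def using assms(3,4) by (auto simp: ominus_def)
    show "M \<subseteq> gen_inv (S1 a0 b0) (ominus M (S1 a0 b0 ` M))"
      unfolding gen_inv_def
    proof (intro subsetI InterI, elim CollectE conjE)
      fix x K assume x: "x \<in> M" and K: "closed_subspace K" "ominus M (S1 a0 b0 ` M) \<subseteq> K" "S1 a0 b0 ` K \<subseteq> K"
      have "(\<lambda>n. 1 * \<phi> n) \<in> ominus M (S1 a0 b0 ` M)" unfolding om by blast
      then have phiK: "\<phi> \<in> K" using K(2) by auto
      obtain c h where h: "h \<in> H2" and xe: "x = (\<lambda>n. c * \<phi> n + Mz (cprod u h) n)"
        using dec x by blast
      show "x \<in> K"
        unfolding xe
        by (intro closed_subspace_add[OF K(1)] closed_subspace_scale[OF K(1) phiK]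
            shifted_multiples_in_S1_invariant[OF u p K(1,3) phiK L h])
    qed
  qed
  moreover have "\<exists>\<theta> p \<phi>. inner_fun \<theta> \<and> outer_poly p \<and> \<phi> \<in> H2 \<and>
        ominus M (S1 a0 b0 ` M) = {(\<lambda>n. c * \<phi> n) | c. True} \<and>
        (\<forall>z\<in>ball 0 1. (\<Sum>n. S1 a0 b0 \<phi> n * z ^ n) = z * poly p z * \<theta> z)"
  proof (intro exI conjI ballI)
    show "inner_fun (hardy u)" by (rule inner_fun_hardy[OF u])
    show "outer_poly p" by (rule p)
    show "\<phi> \<in> H2" by (rule closed_subspace_subset[OF assms(3) phi])
    show "ominus M (S1 a0 b0 ` M) = {(\<lambda>n. c * \<phi> n) | c. True}" by (rule om)
    fix z :: complex assume "z \<in> ball 0 1"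
    then have z: "cmod z < 1" by simp
    have uH: "u \<in> H2" using u by (simp add: inner_seq_def)
    have "(\<Sum>n. S1 a0 b0 \<phi> n * z ^ n) = hardy (Mz (cprod u (poly_seq p))) z"
      by (simp add: hardy_def S1_eq_Mz_Lmap L)
    also have "\<dots> = z * (hardy u z * poly p z)"
      by (simp add: hardy_Mz[OF inner_seq_contraction(1)[OF u H2_poly_seq] z]
          hardy_cprod[OF H2_poly_seq uH z] hardy_poly_seq)
    finally show "(\<Sum>n. S1 a0 b0 \<phi> n * z ^ n) = z * poly p z * hardy u z" by (simp add: mult.commute mult.left_commute)
  qed
  ultimately show ?thesis by blast
qed

end
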